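(* Let $n\ge 1$. For every non-crossing geometric tree $T$ on the $n$ vertices $\{1,\dots,n\}$ there is a vertex $w\in F_n$ of the Hurwitz graph $\mathcal{H}(S_n)$ such that $\Gamma(w)=T$ and $w$ is central in $\mathcal{H}(S_n)$.
   Context: $F_n$ is the set of all words $(t_1,\dots,t_{n-1})$ of $n-1$ transpositions in the symmetric group $S_n$ whose product $t_1\cdots t_{n-1}$ equals the $n$-cycle $c=(1,2,\dots,n)$ (these correspond bijectively to maximal chains in the non-crossing partition lattice). Permutations are multiplied as functions, right to left. With $g^h:=h^{-1}gh$, for $1\le i\le n-2$ and $v=(t_1,\dots,t_{n-1})\in F_n$ the right and left Hurwitz actions are $R_i(v)=(t_1,\dots,t_{i-1},t_{i+1}^{t_i},t_i,t_{i+2},\dots,t_{n-1})$ and $L_i(v)=(t_1,\dots,t_{i-1},t_{i+1},t_i^{t_{i+1}},t_{i+2},\dots,t_{n-1})$. The Hurwitz graph $\mathcal{H}(S_n)$ has vertex set $F_n$, and two vertices are adjacent if one is obtained from the other by applying some $R_i$ or $L_i$. A central vertex of a connected finite graph is a vertex whose eccentricity (maximum distance to another vertex) equals the radius (the minimum eccentricity). For a word $w=((a_1\ b_1),\dots,(a_k\ b_k))$ of transpositions in $S_n$, $\Gamma(w)$ is the geometric graph with vertices $1,\dots,n$ drawn clockwise on a circle and edges the straight segments joining $a_i$ and $b_i$, $1\le i\le k$. A non-crossing geometric tree is such a graph that is a tree and in which any two edges intersect only in a common vertex (if at all). *)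

theory Defs
  imports
    "HOL-Analysis.Line_Segment"
    "HOL-Combinatorics.Perm"
    "Graph_Theory.Pair_Digraph"
    "Graph_Theory.Digraph_Component"
    "Graph_Theory.Shortest_Path"
begin

section \<open>Factorizations of the long cycle\<close>

text \<open>
  Elements of the symmetric group on \<open>{1..n}\<close> are finitely supported permutations of \<open>nat\<close>
  fixing everything outside \<open>{1..n}\<close>. Multiplication is composition, so products are read from
  right to left.
\<close>

definition transpositions :: "nat \<Rightarrow> nat perm set" where
  "transpositions n = {Perm.swap a b | a b. a \<in> {1..n} \<and> b \<in> {1..n} \<and> a \<noteq> b}"

definition long_cycle :: "nat \<Rightarrow> nat perm" where
  "long_cycle n = Perm.cycle [1..<Suc n]"

definition factorizations :: "nat \<Rightarrow> nat perm list set" where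
  "factorizations n =
    {w. length w = n - 1 \<and> set w \<subseteq> transpositions n \<and> prod_list w = long_cycle n}"


section \<open>The Hurwitz graph\<close>

definition conj_by :: "'a perm \<Rightarrow> 'a perm \<Rightarrow> 'a perm" where
  "conj_by h g = inverse h * g * h"

text \<open>
  The index \<open>i\<close> of the moves is 1-based, lists are 0-based: the letters \<open>t\<^sub>i\<close> and \<open>t\<^bsub>i+1\<^esub>\<close>
  of \<open>v\<close> are \<open>v ! (i - 1)\<close> and \<open>v ! i\<close>.
\<close>

definition hurwitz_R :: "nat \<Rightarrow> 'a perm list \<Rightarrow> 'a perm list" where
  "hurwitz_R i v = v[i - 1 := conj_by (v ! (i - 1)) (v ! i), i := v ! (i - 1)]"

definition hurwitz_L :: "nat \<Rightarrow> 'a perm list \<Rightarrow> 'a perm list" where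
  "hurwitz_L i v = v[i - 1 := v ! i, i := conj_by (v ! i) (v ! (i - 1))]"

definition hurwitz_step :: "nat \<Rightarrow> 'a perm list \<Rightarrow> 'a perm list \<Rightarrow> bool" where
  "hurwitz_step n v w \<longleftrightarrow> (\<exists>i. 1 \<le> i \<and> i \<le> n - 2 \<and> (w = hurwitz_R i v \<or> w = hurwitz_L i v))"

text \<open>Undirected graphs are represented as symmetric digraphs.\<close>

definition hurwitz_graph :: "nat \<Rightarrow> nat perm list pair_pre_digraph" where
  "hurwitz_graph n =
    \<lparr> pverts = factorizations n,
      parcs = {(v, w). v \<in> factorizations n \<and> w \<in> factorizations n \<and>
                       (hurwitz_step n v w \<or> hurwitz_step n w v)} \<rparr>"


section \<open>Central vertices\<close>

definition graph_dist :: "'a pair_pre_digraph \<Rightarrow> 'a \<Rightarrow> 'a \<Rightarrow> ereal" where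
  "graph_dist G u v = wf_digraph.\<mu> (with_proj G) (\<lambda>_. 1) u v"

definition eccentricity :: "'a pair_pre_digraph \<Rightarrow> 'a \<Rightarrow> ereal" where
  "eccentricity G v = Max ((\<lambda>u. graph_dist G v u) ` pverts G)"

definition radius :: "'a pair_pre_digraph \<Rightarrow> ereal" where
  "radius G = Min (eccentricity G ` pverts G)"

definition central_vertex :: "'a pair_pre_digraph \<Rightarrow> 'a \<Rightarrow> bool" where
  "central_vertex G v \<longleftrightarrow>
    pair_graph G \<and> Digraph_Component.connected (with_proj G) \<and>
    v \<in> pverts G \<and> eccentricity G v = radius G"


section \<open>Geometric graphs on points of a circle\<close>

definition clockwise_on_circle :: "nat \<Rightarrow> (nat \<Rightarrow> complex) \<Rightarrow> bool" where
  "clockwise_on_circle n p \<longleftrightarrow>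
    (\<exists>z r \<theta>. r > 0 \<and>
       (\<forall>i\<in>{1..n}. p i = z + of_real r * cis (\<theta> i)) \<and>
       (\<forall>i\<in>{1..n}. \<forall>j\<in>{1..n}. i < j \<longrightarrow> \<theta> j < \<theta> i \<and> \<theta> i < \<theta> j + 2 * pi))"

definition \<Gamma> :: "nat \<Rightarrow> nat perm list \<Rightarrow> nat pair_pre_digraph" where
  "\<Gamma> n w =
    \<lparr> pverts = {1..n},
      parcs = {(a, b). a \<in> {1..n} \<and> b \<in> {1..n} \<and> a \<noteq> b \<and> Perm.swap a b \<in> set w} \<rparr>"

text \<open>
  Every edge of a symmetric digraph gives a directed cycle of length 2, so
  \<^const>\<open>Digraph_Component.tree\<close> is not the undirected notion. The cycles of the undirected graph
  are the directed cycles of length at least 3.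
\<close>

definition undirected_tree :: "'a pair_pre_digraph \<Rightarrow> bool" where
  "undirected_tree T \<longleftrightarrow>
    pair_graph T \<and> Digraph_Component.connected (with_proj T) \<and>
    \<not> (\<exists>c. pre_digraph.cycle (with_proj T) c \<and> length c \<ge> 3)"

definition non_crossing :: "('a \<Rightarrow> complex) \<Rightarrow> 'a pair_pre_digraph \<Rightarrow> bool" where
  "non_crossing p G \<longleftrightarrow>
    (\<forall>(a, b) \<in> parcs G. \<forall>(c, d) \<in> parcs G. {a, b} \<noteq> {c, d} \<longrightarrow>
       closed_segment (p a) (p b) \<inter> closed_segment (p c) (p d) \<subseteq> p ` ({a, b} \<inter> {c, d}))"

definition non_crossing_tree :: "nat \<Rightarrow> (nat \<Rightarrow> complex) \<Rightarrow> nat pair_pre_digraph \<Rightarrow> bool" where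
  "non_crossing_tree n p T \<longleftrightarrow> pverts T = {1..n} \<and> undirected_tree T \<and> non_crossing p T"

end

theory Submission
  imports Defs
begin

text \<open>
  The radius of the Hurwitz graph is \<open>(n - 1) choose 2\<close>, and every non-crossing tree is the graph of
  a word from which all other words are at most that far away.

  \<^emph>\<open>Lower bound.\<close> The letters of a factorization, read from left to right, merge the \<open>n\<close> one-point
  components of the empty graph into one. Each letter merges two components and thus eliminates one
  number, the larger one of their least points, from the list of least points. This assigns an
  order of \<open>2, \<dots>, n\<close> to each factorization. A Hurwitz move changes the partition after one prefix
  only, so it exchanges at most two neighbours in that order (\<open>elimination_pairs_move\<close>). All orders
  occur (\<open>elimination_order_exists\<close>), hence for each factorization there is one with the reverse
  order, and its distance is at least the number \<open>(n - 1) choose 2\<close> of inversions between the two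
  (\<open>distant_factorization\<close>).

  \<^emph>\<open>Upper bound.\<close> A non-crossing tree has a leaf whose neighbour is next to it on the circle
  (\<open>consecutive_leaf_exists\<close>). Let \<open>t\<close> be the transposition of these two points. Depending on which of
  them is the leaf, \<open>t c\<close> or \<open>c t\<close> is the cycle \<open>c\<close> with the leaf left out. So by induction there is a word
  for the tree that starts or ends with \<open>t\<close> and continues with a word for the smaller tree. The long
  cycle maps one of the two points to the other. For this reason \<open>t\<close> can be
  created at the front, or at the back, of every factorization by \<open>n - 2\<close> moves (\<open>move_to_front\<close>,
  \<open>move_to_back\<close>): let a letter travel along the word and conjugate it whenever it meets the path of
  the point. What remains is a factorization of the smaller cycle, and
  \<open>(n - 2) + ((n - 2) choose 2) = (n - 1) choose 2\<close> (\<open>central_word_exists\<close>).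
\<close>

unbundle permutation_syntax

section \<open>Hurwitz moves on words\<close>

definition transpositions_on :: "'a set \<Rightarrow> 'a perm set" where
  "transpositions_on S = {\<langle>a \<leftrightarrow> b\<rangle> | a b. a \<in> S \<and> b \<in> S \<and> a \<noteq> b}"

lemma transpositions_onE:
  assumes "t \<in> transpositions_on S"
  obtains a b where "t = \<langle>a \<leftrightarrow> b\<rangle>" "a \<in> S" "b \<in> S" "a \<noteq> b"
  using assms unfolding transpositions_on_def by blast

lemma transpositions_on_mono: "S \<subseteq> S' \<Longrightarrow> transpositions_on S \<subseteq> transpositions_on S'"
  unfolding transpositions_on_def by blast

lemma swap_in_transpositions_on [simp]:
  "\<langle>a \<leftrightarrow> b\<rangle> \<in> transpositions_on S \<longleftrightarrow> a \<in> S \<and> b \<in> S \<and> a \<noteq> b"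
proof
  assume "\<langle>a \<leftrightarrow> b\<rangle> \<in> transpositions_on S"
  then obtain c d where cd: "\<langle>a \<leftrightarrow> b\<rangle> = \<langle>c \<leftrightarrow> d\<rangle>" "c \<in> S" "d \<in> S" "c \<noteq> d"
    by (rule transpositions_onE)
  have "a \<noteq> b" using cd affected_swap[of c d] by (metis affected_one insert_not_empty swap_1)
  then have "{a, b} = {c, d}" using cd affected_swap by metis
  then show "a \<in> S \<and> b \<in> S \<and> a \<noteq> b" using cd \<open>a \<noteq> b\<close> by auto
qed (auto simp: transpositions_on_def)

lemma swap_eq_iff: "a \<noteq> b \<Longrightarrow> \<langle>a \<leftrightarrow> b\<rangle> = \<langle>c \<leftrightarrow> d\<rangle> \<longleftrightarrow> {a, b} = {c, d}"
  by (metis affected_swap affected_one doubleton_eq_iff insert_not_empty swap_1 swap_sym)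

lemma mult_swap: "g * \<langle>a \<leftrightarrow> b\<rangle> = \<langle>g \<langle>$\<rangle> a \<leftrightarrow> g \<langle>$\<rangle> b\<rangle> * g"
proof (rule perm_eqI)
  fix c
  show "(g * \<langle>a \<leftrightarrow> b\<rangle>) \<langle>$\<rangle> c = (\<langle>g \<langle>$\<rangle> a \<leftrightarrow> g \<langle>$\<rangle> b\<rangle> * g) \<langle>$\<rangle> c"
    by (cases "c = a"; cases "c = b") (auto simp: apply_times apply_inj)
qed

lemma conj_by_swap: "conj_by h \<langle>a \<leftrightarrow> b\<rangle> = \<langle>inverse h \<langle>$\<rangle> a \<leftrightarrow> inverse h \<langle>$\<rangle> b\<rangle>"
  by (simp add: conj_by_def mult_swap mult.assoc)

text \<open>
  The positions of the Hurwitz action are described by splitting the word around the two letters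
  that change. In this form it is plain that a move can be carried out inside a longer word, and
  that reversing a word exchanges the two kinds of moves.
\<close>

inductive hurwitz_move :: "'a perm list \<Rightarrow> 'a perm list \<Rightarrow> bool" where
  left: "hurwitz_move (P @ [x, y] @ Q) (P @ [y, conj_by y x] @ Q)"
| right: "hurwitz_move (P @ [x, y] @ Q) (P @ [conj_by x y, x] @ Q)"

lemma hurwitz_move_length: "hurwitz_move u v \<Longrightarrow> length v = length u"
  by (induction rule: hurwitz_move.induct) auto

text \<open>
  A right move replaces \<open>x y\<close> by \<open>x\<inverse> y x x\<close>, which is the same only because \<open>x\<close> is an involution.
\<close>

lemma hurwitz_move_prod_list:
  assumes "hurwitz_move u v" "set u \<subseteq> transpositions_on S"
  shows "prod_list v = prod_list u"
  using assms
proof (induction rule: hurwitz_move.induct)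
  case (left P x y Q)
  show ?case by (simp add: conj_by_def mult.assoc[symmetric])
next
  case (right P x y Q)
  then have "inverse x = x" "x * x = 1" by (auto elim!: transpositions_onE)
  moreover from this have "x * (x * z) = z" for z by (simp add: mult.assoc[symmetric])
  ultimately show ?case by (simp add: conj_by_def mult.assoc)
qed

lemma conj_by_transposition:
  assumes "s \<in> transpositions_on S" "t \<in> transpositions_on S"
  shows "conj_by s t \<in> transpositions_on S"
proof -
  obtain a b where ab: "s = \<langle>a \<leftrightarrow> b\<rangle>" "a \<in> S" "b \<in> S" "a \<noteq> b"
    using assms(1) by (rule transpositions_onE)
  obtain c d where cd: "t = \<langle>c \<leftrightarrow> d\<rangle>" "c \<in> S" "d \<in> S" "c \<noteq> d"
    using assms(2) by (rule transpositions_onE)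
  have "s \<langle>$\<rangle> e \<in> S" if "e \<in> S" for e
    using ab that by (cases "e = a"; cases "e = b") auto
  then show ?thesis
    using ab cd by (simp add: conj_by_swap apply_inj)
qed

lemma hurwitz_move_letters:
  "hurwitz_move u v \<Longrightarrow> set u \<subseteq> transpositions_on S \<Longrightarrow> set v \<subseteq> transpositions_on S"
  by (induction rule: hurwitz_move.induct) (auto intro: conj_by_transposition)

lemma hurwitz_move_context: "hurwitz_move u v \<Longrightarrow> hurwitz_move (A @ u @ B) (A @ v @ B)"
proof (induction rule: hurwitz_move.induct)
  case (left P x y Q)
  show ?case using hurwitz_move.left[of "A @ P" x y "Q @ B"] by simp
next
  case (right P x y Q)
  show ?case using hurwitz_move.right[of "A @ P" x y "Q @ B"] by simp
qed

lemma hurwitz_move_rev: "hurwitz_move u v \<Longrightarrow> hurwitz_move (rev u) (rev v)"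
proof (induction rule: hurwitz_move.induct)
  case (left P x y Q)
  show ?case using hurwitz_move.right[of "rev Q" y x "rev P"] by simp
next
  case (right P x y Q)
  show ?case using hurwitz_move.left[of "rev Q" y x "rev P"] by simp
qed

definition within_moves :: "nat \<Rightarrow> 'a perm list \<Rightarrow> 'a perm list \<Rightarrow> bool" where
  "within_moves k u v \<longleftrightarrow> (\<exists>j\<le>k. (hurwitz_move ^^ j) u v)"

lemma within_moves_refl [simp, intro]: "within_moves k u u"
  unfolding within_moves_def by (rule exI[of _ 0]) simp

lemma within_moves_mono: "within_moves k u v \<Longrightarrow> k \<le> k' \<Longrightarrow> within_moves k' u v"
  unfolding within_moves_def using le_trans by blast

lemma within_moves_trans:
  "within_moves k u v \<Longrightarrow> within_moves l v w \<Longrightarrow> within_moves (k + l) u w"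
  unfolding within_moves_def relpowp_add by (metis add_mono relpowp_add relcomppI)

lemma within_moves_Suc: "hurwitz_move u v \<Longrightarrow> within_moves k v w \<Longrightarrow> within_moves (Suc k) u w"
  unfolding within_moves_def by (metis Suc_le_mono relpowp_Suc_I2)

lemma within_moves_transfer:
  assumes "within_moves k u v" "\<And>x y. hurwitz_move x y \<Longrightarrow> hurwitz_move (f x) (f y)"
  shows "within_moves k (f u) (f v)"
proof -
  have "(hurwitz_move ^^ j) x y \<Longrightarrow> (hurwitz_move ^^ j) (f x) (f y)" for j x y
    by (induction j arbitrary: y) (use assms(2) in \<open>auto intro: relcomppI\<close>)
  then show ?thesis using assms(1) unfolding within_moves_def by blast
qed

lemma within_moves_append: "within_moves k u v \<Longrightarrow> within_moves k (u @ B) (v @ B)"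
  using within_moves_transfer[of k u v "\<lambda>u. u @ B"] hurwitz_move_context[of _ _ "[]" B] by simp

lemma within_moves_Cons: "within_moves k u v \<Longrightarrow> within_moves k (x # u) (x # v)"
  using within_moves_transfer[of k u v "\<lambda>u. x # u"] hurwitz_move_context[of _ _ "[x]" "[]"] by simp

lemma within_moves_rev: "within_moves k u v \<Longrightarrow> within_moves k (rev u) (rev v)"
  by (rule within_moves_transfer[where f = rev]) (auto intro: hurwitz_move_rev)

lemma within_moves_invariants:
  assumes "within_moves k u v" "set u \<subseteq> transpositions_on S"
  shows "length v = length u \<and> prod_list v = prod_list u \<and> set v \<subseteq> transpositions_on S"
proof -
  have "length v = length u \<and> prod_list v = prod_list u \<and> set v \<subseteq> transpositions_on S"
    if "(hurwitz_move ^^ j) u v" for j v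
    using that
  proof (induction j arbitrary: v)
    case 0
    then show ?case using assms(2) by simp
  next
    case (Suc j)
    then obtain v' where "(hurwitz_move ^^ j) u v'" "hurwitz_move v' v" by auto
    then show ?case
      using Suc.IH[of v'] hurwitz_move_length hurwitz_move_prod_list hurwitz_move_letters by metis
  qed
  then show ?thesis using assms(1) unfolding within_moves_def by blast
qed

lemma transposition_moving:
  assumes "t \<in> transpositions_on S" "t \<langle>$\<rangle> a \<noteq> a"
  shows "t = \<langle>a \<leftrightarrow> t \<langle>$\<rangle> a\<rangle>"
proof -
  obtain c d where "t = \<langle>c \<leftrightarrow> d\<rangle>" using assms(1) by (rule transpositions_onE)
  then show ?thesis using assms(2) by (cases "a = c"; cases "a = d") (auto simp: swap_sym)
qed

text \<open>
  The rightmost letter moving \<open>a\<close> is some \<open>\<langle>a \<leftrightarrow> p\<rangle>\<close>, and the letters in front of it carry \<open>p\<close> to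
  \<open>b\<close>. Move this letter to the left: past a letter that fixes \<open>p\<close> it goes unchanged, and past a
  letter \<open>\<langle>p \<leftrightarrow> q\<rangle>\<close> it turns into \<open>\<langle>a \<leftrightarrow> q\<rangle>\<close>. In this way its second point follows the path of \<open>a\<close>
  under the product, and arrives at the front as \<open>b\<close>.
\<close>

lemma move_to_front:
  assumes "set u \<subseteq> transpositions_on UNIV" "prod_list u \<langle>$\<rangle> a = b" "a \<noteq> b"
  shows "\<exists>v. within_moves (length u - 1) u (\<langle>a \<leftrightarrow> b\<rangle> # v)"
  using assms
proof (induction u rule: length_induct)
  case (1 u)
  have IH: "\<exists>v. within_moves (length u' - 1) u' (\<langle>a \<leftrightarrow> b\<rangle> # v)"
    if "length u' < length u" "set u' \<subseteq> transpositions_on UNIV" "prod_list u' \<langle>$\<rangle> a = b" for u'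
    using 1 that by blast
  have IH': "\<exists>v. within_moves (length u - 2) (u' @ z) (\<langle>a \<leftrightarrow> b\<rangle> # v)"
    if u': "length u' < length u" "set u' \<subseteq> transpositions_on UNIV" "prod_list u' \<langle>$\<rangle> a = b" for u' z
  proof -
    obtain v where v: "within_moves (length u' - 1) u' (\<langle>a \<leftrightarrow> b\<rangle> # v)" using IH[OF u'] by blast
    have "within_moves (length u - 2) (u' @ z) (\<langle>a \<leftrightarrow> b\<rangle> # (v @ z))"
      using within_moves_mono[OF within_moves_append[OF v, of z], of "length u - 2"] u'(1) by simp
    then show ?thesis by blast
  qed
  have "u \<noteq> []" using 1 by auto
  then obtain u1 x where u: "u = u1 @ [x]" by (metis rev_exhaust)
  have x: "x \<in> transpositions_on UNIV" using 1 u by simp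
  show ?case
  proof (cases "x \<langle>$\<rangle> a = a")
    case True
    then have "prod_list u1 \<langle>$\<rangle> a = b" using 1 u by (simp add: apply_times)
    then obtain v where "within_moves (length u - 2) (u1 @ [x]) (\<langle>a \<leftrightarrow> b\<rangle> # v)"
      using IH'[of u1 "[x]"] u 1 by auto
    then show ?thesis using u within_moves_mono[of "length u - 2" u _ "length u - 1"] by auto
  next
    case False
    define p where "p = x \<langle>$\<rangle> a"
    have xp: "x = \<langle>a \<leftrightarrow> p\<rangle>" "p \<noteq> a" using transposition_moving[OF x] False p_def by auto
    show ?thesis
    proof (cases "u1 = []")
      case True
      then have "u = [\<langle>a \<leftrightarrow> b\<rangle>]" using u 1 xp by simp
      then show ?thesis by auto
    next
      case False
      then obtain Q y where u1: "u1 = Q @ [y]" by (metis rev_exhaust)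
      have y: "y \<in> transpositions_on UNIV" and Q: "set Q \<subseteq> transpositions_on UNIV"
        using 1 u u1 by auto
      have Qyp: "prod_list Q \<langle>$\<rangle> (y \<langle>$\<rangle> p) = b" using 1 u u1 xp by (simp add: apply_times)
      consider "y \<langle>$\<rangle> p = p" | "y \<langle>$\<rangle> p = a" | "y \<langle>$\<rangle> p \<noteq> p" "y \<langle>$\<rangle> p \<noteq> a" by blast
      then show ?thesis
      proof cases
        case 1
        then have "prod_list (Q @ [x]) \<langle>$\<rangle> a = b" using Qyp xp by (simp add: apply_times)
        then obtain v where "within_moves (length u - 2) ((Q @ [x]) @ [conj_by x y]) (\<langle>a \<leftrightarrow> b\<rangle> # v)"
          using IH'[of "Q @ [x]" "[conj_by x y]"] x Q u u1 by auto
        moreover have "hurwitz_move u ((Q @ [x]) @ [conj_by x y])"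
          using hurwitz_move.left[of Q y x "[]"] u u1 by simp
        ultimately have "within_moves (Suc (length u - 2)) u (\<langle>a \<leftrightarrow> b\<rangle> # v)"
          by (rule within_moves_Suc[rotated])
        then show ?thesis using u u1 by auto
      next
        case 2
        \<comment> \<open>Here \<open>y = x\<close>: the two letters cancel in the product, and an earlier letter moving \<open>a\<close>
          takes over.\<close>
        then have "prod_list Q \<langle>$\<rangle> a = b" using Qyp by simp
        then obtain v where "within_moves (length u - 2) (Q @ [y, x]) (\<langle>a \<leftrightarrow> b\<rangle> # v)"
          using IH'[of Q "[y, x]"] Q u u1 by auto
        then show ?thesis using u u1 within_moves_mono[of "length u - 2" u _ "length u - 1"] by auto
      next
        case 3
        define q where "q = y \<langle>$\<rangle> p"
        have yq: "y = \<langle>p \<leftrightarrow> q\<rangle>" using transposition_moving[OF y] 3 q_def by auto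
        have c: "conj_by y x = \<langle>a \<leftrightarrow> q\<rangle>"
          using xp 3 unfolding xp(1) conj_by_swap by (simp add: yq)
        have "prod_list (Q @ [\<langle>a \<leftrightarrow> q\<rangle>]) \<langle>$\<rangle> a = b" using Qyp q_def by (simp add: apply_times)
        then obtain v where "within_moves (length u - 2) ((Q @ [\<langle>a \<leftrightarrow> q\<rangle>]) @ [y]) (\<langle>a \<leftrightarrow> b\<rangle> # v)"
          using IH'[of "Q @ [\<langle>a \<leftrightarrow> q\<rangle>]" "[y]"] 3 q_def Q u u1 by auto
        moreover have "hurwitz_move u ((Q @ [\<langle>a \<leftrightarrow> q\<rangle>]) @ [y])"
          using hurwitz_move.right[of Q y x "[]"] u u1 c by simp
        ultimately have "within_moves (Suc (length u - 2)) u (\<langle>a \<leftrightarrow> b\<rangle> # v)"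
          by (rule within_moves_Suc[rotated])
        then show ?thesis using u u1 by auto
      qed
    qed
  qed
qed

lemma inverse_prod_list_transpositions:
  "set u \<subseteq> transpositions_on S \<Longrightarrow> prod_list (rev u) = inverse (prod_list u)"
proof (induction u)
  case (Cons t u)
  then have "inverse t = t" by (auto elim: transpositions_onE)
  then show ?case using Cons by simp
qed simp

text \<open>
  Reversing a word of transpositions inverts its product, so this is the statement about the front
  for the reversed word.
\<close>

lemma move_to_back:
  assumes "set u \<subseteq> transpositions_on UNIV" "prod_list u \<langle>$\<rangle> a = b" "a \<noteq> b"
  shows "\<exists>v. within_moves (length u - 1) u (v @ [\<langle>a \<leftrightarrow> b\<rangle>])"
proof -
  have "prod_list (rev u) \<langle>$\<rangle> b = a"
    using assms by (auto simp: inverse_prod_list_transpositions apply_sequence)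
  then obtain v where "within_moves (length u - 1) (rev u) (\<langle>b \<leftrightarrow> a\<rangle> # v)"
    using move_to_front[of "rev u" b a] assms by auto
  from within_moves_rev[OF this] show ?thesis
    by (auto simp: swap_sym)
qed

section \<open>Cycles\<close>

lemma cycle_apply_notin: "x \<notin> set xs \<Longrightarrow> \<langle>xs\<rangle> \<langle>$\<rangle> x = x"
  by (induction xs rule: cycle.induct) (auto simp: apply_times)

lemma cycle_insert_after:
  assumes "distinct (xs @ a # b # ys)"
  shows "\<langle>xs @ a # b # ys\<rangle> = \<langle>xs @ a # ys\<rangle> * \<langle>a \<leftrightarrow> b\<rangle>"
  using assms
proof (induction xs rule: length_induct)
  case (1 xs)
  show ?case
  proof (cases xs)
    case Nil
    then show ?thesis by simp
  next
    case (Cons x xs1)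
    show ?thesis
    proof (cases xs1)
      case Nil
      have "\<langle>x \<leftrightarrow> b\<rangle> * \<langle>x \<leftrightarrow> a\<rangle> = \<langle>x \<leftrightarrow> a\<rangle> * \<langle>a \<leftrightarrow> b\<rangle>"
        using 1(2) Cons mult_swap[of "\<langle>x \<leftrightarrow> a\<rangle>" a b] by auto
      then show ?thesis
        using Cons Nil by (simp add: mult.assoc)
    next
      case (Cons y xs2)
      have "\<langle>(x # xs2) @ a # b # ys\<rangle> = \<langle>(x # xs2) @ a # ys\<rangle> * \<langle>a \<leftrightarrow> b\<rangle>"
        using 1(1)[rule_format, of "x # xs2"] 1(2) Cons \<open>xs = x # xs1\<close> by simp
      moreover have "\<langle>a \<leftrightarrow> b\<rangle> * \<langle>x \<leftrightarrow> y\<rangle> = \<langle>x \<leftrightarrow> y\<rangle> * \<langle>a \<leftrightarrow> b\<rangle>"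
        using 1(2) Cons \<open>xs = x # xs1\<close> mult_swap[of "\<langle>a \<leftrightarrow> b\<rangle>" x y] by auto
      ultimately show ?thesis
        using Cons \<open>xs = x # xs1\<close> by (simp add: mult.assoc)
    qed
  qed
qed

lemma mult_cycle: "g * \<langle>xs\<rangle> = \<langle>map (apply g) xs\<rangle> * g"
proof (induction xs rule: cycle.induct)
  case (3 a b as)
  have "g * \<langle>a # b # as\<rangle> = (g * \<langle>a # as\<rangle>) * \<langle>a \<leftrightarrow> b\<rangle>" by (simp add: mult.assoc)
  also have "\<dots> = \<langle>map (apply g) (a # as)\<rangle> * (g * \<langle>a \<leftrightarrow> b\<rangle>)" by (simp only: 3 mult.assoc)
  also have "\<dots> = \<langle>map (apply g) (a # b # as)\<rangle> * g" by (simp only: mult_swap[of g] list.map cycle.simps mult.assoc)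
  finally show ?case .
qed simp_all

text \<open>
  By \<open>cycle_insert_after\<close>, the left-hand side is the cycle without \<open>b\<close>, conjugated by \<open>\<langle>a \<leftrightarrow> b\<rangle>\<close>;
  conjugation relabels its entry \<open>a\<close> as \<open>b\<close>.
\<close>

lemma swap_mult_cycle:
  assumes "distinct (xs @ a # b # ys)"
  shows "\<langle>a \<leftrightarrow> b\<rangle> * \<langle>xs @ a # b # ys\<rangle> = \<langle>xs @ b # ys\<rangle>"
proof -
  have "map (apply \<langle>a \<leftrightarrow> b\<rangle>) (xs @ a # ys) = xs @ b # ys"
    using assms by (auto intro!: map_idI apply_swap_same)
  then have "\<langle>a \<leftrightarrow> b\<rangle> * \<langle>xs @ a # ys\<rangle> = \<langle>xs @ b # ys\<rangle> * \<langle>a \<leftrightarrow> b\<rangle>"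
    using mult_cycle[of "\<langle>a \<leftrightarrow> b\<rangle>" "xs @ a # ys"] by simp
  then show ?thesis
    using cycle_insert_after[OF assms] by (simp add: mult.assoc[symmetric]) (simp add: mult.assoc)
qed

lemma cycle_mult_swap:
  assumes "distinct (xs @ a # b # ys)"
  shows "\<langle>xs @ a # b # ys\<rangle> * \<langle>a \<leftrightarrow> b\<rangle> = \<langle>xs @ a # ys\<rangle>"
  using cycle_insert_after[OF assms] by (simp add: mult.assoc)

lemma cycle_apply_next:
  assumes "distinct (xs @ a # b # ys)"
  shows "\<langle>xs @ a # b # ys\<rangle> \<langle>$\<rangle> a = b"
proof -
  have "\<langle>xs @ a # ys\<rangle> \<langle>$\<rangle> b = b" using assms by (intro cycle_apply_notin) auto
  then show ?thesis using cycle_insert_after[OF assms] by (simp add: apply_times)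
qed


section \<open>Components of the graph of a word\<close>

text \<open>
  The components of the graph of a word \<open>w\<close> are the classes of \<open>(links (set w))\<^sup>*\<close>.
\<close>

definition links :: "'a perm set \<Rightarrow> 'a rel" where
  "links A = {(a, b). a \<noteq> b \<and> \<langle>a \<leftrightarrow> b\<rangle> \<in> A}"

lemma links_sym: "(x, y) \<in> (links A)\<^sup>* \<Longrightarrow> (y, x) \<in> (links A)\<^sup>*"
proof -
  have "sym (links A)" by (auto simp: links_def sym_def swap_sym)
  then show "(x, y) \<in> (links A)\<^sup>* \<Longrightarrow> (y, x) \<in> (links A)\<^sup>*" by (metis sym_rtrancl symD)
qed

lemma links_mono: "A \<subseteq> B \<Longrightarrow> (links A)\<^sup>* \<subseteq> (links B)\<^sup>*"
  by (rule rtrancl_mono) (auto simp: links_def)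

lemma links_insert_swap:
  "a \<noteq> b \<Longrightarrow> links (insert \<langle>a \<leftrightarrow> b\<rangle> A) = insert (a, b) (insert (b, a) (links A))"
  by (auto simp: links_def swap_eq_iff doubleton_eq_iff)

lemma apply_in_links:
  assumes "t \<in> transpositions_on S" "t \<in> A"
  shows "(t \<langle>$\<rangle> x, x) \<in> (links A)\<^sup>*"
proof (cases "t \<langle>$\<rangle> x = x")
  case False
  then have "(x, t \<langle>$\<rangle> x) \<in> links A"
    using transposition_moving[OF assms(1)] assms(2) by (metis (mono_tags, lifting) links_def mem_Collect_eq case_prodI)
  then show ?thesis by (blast intro: links_sym)
qed simp

lemma prod_list_in_links:
  assumes "set w \<subseteq> transpositions_on S"
  shows "(prod_list w \<langle>$\<rangle> x, x) \<in> (links (set w))\<^sup>*"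
  using assms
proof (induction w)
  case (Cons t w)
  have "(t \<langle>$\<rangle> (prod_list w \<langle>$\<rangle> x), prod_list w \<langle>$\<rangle> x) \<in> (links (set (t # w)))\<^sup>*"
    using apply_in_links[of t S] Cons.prems by simp
  moreover have "(prod_list w \<langle>$\<rangle> x, x) \<in> (links (set (t # w)))\<^sup>*"
    using Cons links_mono[of "set w" "set (t # w)"] by auto
  ultimately show ?case by (simp add: apply_times)
qed simp

text \<open>
  A product of transpositions moves every point within its component, so a product that is a cycle
  connects all its entries.
\<close>

lemma cycle_connected:
  assumes "set w \<subseteq> transpositions_on S" "prod_list w = \<langle>xs\<rangle>" "distinct xs" "x \<in> set xs" "y \<in> set xs"
  shows "(x, y) \<in> (links (set w))\<^sup>*"
proof -
  have hd: "(hd xs, xs ! i) \<in> (links (set w))\<^sup>*" if "i < length xs" for i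
    using that
  proof (induction i)
    case (Suc i)
    have "xs = take i xs @ xs ! i # xs ! Suc i # drop (Suc (Suc i)) xs"
      using Suc.prems by (metis Cons_nth_drop_Suc Suc_lessD id_take_nth_drop)
    then have "\<langle>xs\<rangle> \<langle>$\<rangle> (xs ! i) = xs ! Suc i"
      using cycle_apply_next[of "take i xs" "xs ! i" "xs ! Suc i"] assms(3) by metis
    then have "(xs ! i, xs ! Suc i) \<in> (links (set w))\<^sup>*"
      using prod_list_in_links[OF assms(1)] assms(2) links_sym by metis
    then show ?case using Suc by auto
  qed (auto simp: hd_conv_nth)
  show ?thesis using hd assms(4,5) links_sym by (metis in_set_conv_nth rtrancl_trans)
qed

text \<open>
  The least points of the components serve as names for the components: counting them counts
  components, and keeping track of which of them disappears tells which components merge.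
\<close>

definition minima :: "nat set \<Rightarrow> nat perm set \<Rightarrow> nat set" where
  "minima S A = {x \<in> S. \<forall>y. (x, y) \<in> (links A)\<^sup>* \<longrightarrow> x \<le> y}"

lemma minima_subset: "minima S A \<subseteq> S"
  by (auto simp: minima_def)

lemma minima_antimono: "A \<subseteq> B \<Longrightarrow> minima S B \<subseteq> minima S A"
  unfolding minima_def using links_mono[of A B] by blast

lemma minima_empty [simp]: "minima S {} = S"
  by (auto simp: minima_def links_def)

text \<open>
  A new edge merges at most two components, and only the larger one of their two least points is
  lost.
\<close>

lemma minima_insert_unique:
  assumes t: "t \<in> transpositions_on S'"
    and x: "x \<in> minima S A - minima S (insert t A)"
    and y: "y \<in> minima S A - minima S (insert t A)"
  shows "x = y"
proof -
  obtain a b where ab: "t = \<langle>a \<leftrightarrow> b\<rangle>" "a \<noteq> b" using t by (rule transpositions_onE)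
  let ?R = "(links A)\<^sup>*"
  \<comment> \<open>A path in the enlarged graph can be shortened so that it uses the new edge at most once.\<close>
  have new: "(u, v) \<in> ?R \<or> (u, a) \<in> ?R \<and> (b, v) \<in> ?R \<or> (u, b) \<in> ?R \<and> (a, v) \<in> ?R"
    if "(u, v) \<in> (links (insert t A))\<^sup>*" for u v
    using that
  proof (induction rule: rtrancl_induct)
    case (step v w)
    then have "(v, w) = (a, b) \<or> (v, w) = (b, a) \<or> (v, w) \<in> links A"
      using ab by (auto simp: links_insert_swap)
    then consider "v = a" "w = b" | "v = b" "w = a" | "(v, w) \<in> links A" by blast
    then show ?case
    proof cases
      case 1
      then show ?thesis using step.IH links_sym rtrancl_trans by blast
    next
      case 2
      then show ?thesis using step.IH links_sym rtrancl_trans by blast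
    next
      case 3
      then show ?thesis using step.IH by (meson rtrancl_into_rtrancl)
    qed
  qed simp
  have merged: "\<exists>z<u. (u, a) \<in> ?R \<and> (b, z) \<in> ?R \<or> (u, b) \<in> ?R \<and> (a, z) \<in> ?R"
    if u: "u \<in> minima S A - minima S (insert t A)" for u
  proof -
    obtain z where z: "(u, z) \<in> (links (insert t A))\<^sup>*" "z < u"
      using u by (force simp: minima_def not_le)
    then have "(u, z) \<notin> ?R" using u by (force simp: minima_def not_le)
    then show ?thesis using new[OF z(1)] z(2) by blast
  qed
  have least: "u \<le> v" if "u \<in> minima S A - minima S (insert t A)" "(u, c) \<in> ?R" "(c, v) \<in> ?R" for u v c
    using that by (auto simp: minima_def dest: rtrancl_trans)
  obtain z where z: "z < x" "(x, a) \<in> ?R \<and> (b, z) \<in> ?R \<or> (x, b) \<in> ?R \<and> (a, z) \<in> ?R"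
    using merged[OF x] by blast
  obtain z' where z': "z' < y" "(y, a) \<in> ?R \<and> (b, z') \<in> ?R \<or> (y, b) \<in> ?R \<and> (a, z') \<in> ?R"
    using merged[OF y] by blast
  consider "(x, a) \<in> ?R" "(y, a) \<in> ?R" | "(x, b) \<in> ?R" "(y, b) \<in> ?R"
    | "(x, a) \<in> ?R" "(b, z) \<in> ?R" "(y, b) \<in> ?R" "(a, z') \<in> ?R"
    | "(x, b) \<in> ?R" "(a, z) \<in> ?R" "(y, a) \<in> ?R" "(b, z') \<in> ?R"
    using z(2) z'(2) by blast
  then show ?thesis
  proof cases
    case 1
    then show ?thesis by (meson le_antisym least[OF x] least[OF y] links_sym)
  next
    case 2
    then show ?thesis by (meson le_antisym least[OF x] least[OF y] links_sym)
  next
    case 3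
    then show ?thesis using least[OF x, of a z'] least[OF y, of b z] z(1) z'(1) by simp
  next
    case 4
    then show ?thesis using least[OF x, of b z'] least[OF y, of a z] z(1) z'(1) by simp
  qed
qed

lemma card_minima_insert:
  assumes "t \<in> transpositions_on S'" "finite S"
  shows "card (minima S A) \<le> card (minima S (insert t A)) + 1"
proof -
  have fin: "finite (minima S B)" for B using assms(2) minima_subset finite_subset by metis
  have "card (minima S A - minima S (insert t A)) \<le> Suc 0"
    using minima_insert_unique[OF assms(1)] fin by (subst card_le_Suc0_iff_eq) auto
  moreover have "minima S (insert t A) \<subseteq> minima S A" by (rule minima_antimono) auto
  ultimately show ?thesis using fin by (simp add: card_Diff_subset)
qed

lemma card_minima_append:
  assumes "set w \<subseteq> transpositions_on S'" "finite S"
  shows "card (minima S A) \<le> card (minima S (A \<union> set w)) + length w"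
  using assms
proof (induction w arbitrary: A)
  case (Cons t w)
  then show ?case
    using card_minima_insert[of t S' S A] Cons.IH[of "insert t A"] by simp
qed simp

lemma card_minima_connected:
  assumes "finite S" "\<And>x y. x \<in> S \<Longrightarrow> y \<in> S \<Longrightarrow> (x, y) \<in> (links A)\<^sup>*"
  shows "card (minima S A) \<le> 1"
proof -
  have "finite (minima S A)" using assms(1) minima_subset finite_subset by metis
  then show ?thesis
    using assms by (auto simp: card_le_Suc0_iff_eq minima_def intro: le_antisym)
qed

text \<open>
  The empty word has \<open>card S\<close> components, and each letter lowers their number by at most one.
\<close>

lemma connecting_word_length:
  fixes S :: "nat set"
  assumes "set w \<subseteq> transpositions_on S'" "finite S"
    and "\<And>x y. x \<in> S \<Longrightarrow> y \<in> S \<Longrightarrow> (x, y) \<in> (links (set w))\<^sup>*"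
  shows "card S \<le> length w + 1"
  using card_minima_append[OF assms(1,2), of "{}"] card_minima_connected[OF assms(2,3)] by simp

section \<open>The lower bound\<close>

text \<open>
  The edge of a conjugated letter joins the images of \<open>c\<close> and \<open>d\<close> under \<open>s\<close>, and these are connected
  through \<open>s\<close>, \<open>\<langle>c \<leftrightarrow> d\<rangle>\<close> and \<open>s\<close> again. Hence Hurwitz moves do not change components.
\<close>

lemma links_conj_by:
  assumes "s \<in> transpositions_on S" "t \<in> transpositions_on S"
  shows "links (insert s (insert (conj_by s t) A)) \<subseteq> (links (insert s (insert t A)))\<^sup>*"
proof (rule subrelI)
  let ?B = "insert s (insert t A)"
  fix p q
  assume pq: "(p, q) \<in> links (insert s (insert (conj_by s t) A))"
  show "(p, q) \<in> (links ?B)\<^sup>*"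
  proof (cases "\<langle>p \<leftrightarrow> q\<rangle> = conj_by s t")
    case False
    then have "(p, q) \<in> links ?B" using pq by (auto simp: links_def)
    then show ?thesis by blast
  next
    case True
    obtain c d where cd: "t = \<langle>c \<leftrightarrow> d\<rangle>" "c \<noteq> d" using assms(2) by (rule transpositions_onE)
    have "inverse s = s" using assms(1) by (auto elim: transpositions_onE)
    then have "conj_by s t = \<langle>s \<langle>$\<rangle> c \<leftrightarrow> s \<langle>$\<rangle> d\<rangle>" using cd by (simp add: conj_by_swap)
    then have "{p, q} = {s \<langle>$\<rangle> c, s \<langle>$\<rangle> d}"
      using True cd pq by (simp add: links_def swap_eq_iff)
    moreover have "(s \<langle>$\<rangle> c, s \<langle>$\<rangle> d) \<in> (links ?B)\<^sup>*"
    proof -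
      have "(s \<langle>$\<rangle> c, c) \<in> (links ?B)\<^sup>*" "(s \<langle>$\<rangle> d, d) \<in> (links ?B)\<^sup>*"
        using apply_in_links[OF assms(1), of ?B] by auto
      moreover have "(c, d) \<in> (links ?B)\<^sup>*" using cd by (auto simp: links_def)
      ultimately show ?thesis by (meson links_sym rtrancl_trans)
    qed
    ultimately show ?thesis using links_sym by (metis doubleton_eq_iff)
  qed
qed

lemma links_conj_by_eq:
  assumes "s \<in> transpositions_on S" "t \<in> transpositions_on S"
  shows "(links (insert s (insert (conj_by s t) A)))\<^sup>* = (links (insert s (insert t A)))\<^sup>*"
proof (rule subset_antisym)
  show "(links (insert s (insert (conj_by s t) A)))\<^sup>* \<subseteq> (links (insert s (insert t A)))\<^sup>*"
    using links_conj_by[OF assms] by (rule rtrancl_subset_rtrancl)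
  have s: "inverse s = s" "s * s = 1" using assms(1) by (auto elim!: transpositions_onE)
  have "conj_by s (conj_by s t) = (s * s) * t * (s * s)" using s(1) by (simp add: conj_by_def mult.assoc)
  then have "conj_by s (conj_by s t) = t" using s(2) by simp
  then show "(links (insert s (insert t A)))\<^sup>* \<subseteq> (links (insert s (insert (conj_by s t) A)))\<^sup>*"
    using links_conj_by[OF assms(1) conj_by_transposition[OF assms], of A] by (simp add: rtrancl_subset_rtrancl)
qed

definition prefix_minima :: "nat \<Rightarrow> nat perm list \<Rightarrow> nat \<Rightarrow> nat set" where
  "prefix_minima n w j = minima {1..n} (set (take j w))"

lemma prefix_minima_antimono: "i \<le> j \<Longrightarrow> prefix_minima n w j \<subseteq> prefix_minima n w i"
  unfolding prefix_minima_def by (intro minima_antimono set_take_subset_set_take)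

text \<open>
  A prefix that ends before the changed letters is not affected, and one that contains both of them
  keeps its components. Only the prefix that ends between them can change.
\<close>

lemma prefix_minima_move:
  assumes "hurwitz_move v w" "set v \<subseteq> transpositions_on S"
  obtains i where "\<And>j. j \<noteq> Suc i \<Longrightarrow> prefix_minima n v j = prefix_minima n w j" "Suc i < length v"
proof -
  have main: "\<exists>i. (\<forall>j. j \<noteq> Suc i \<longrightarrow> prefix_minima n v j = prefix_minima n w j) \<and> Suc i < length v"
    if vw: "v = P @ [x, y] @ Q" "w = P @ [x', y'] @ Q"
      and eq: "\<And>A. (links (insert x (insert y A)))\<^sup>* = (links (insert x' (insert y' A)))\<^sup>*"
    for P Q x y x' y'
  proof (intro exI[of _ "length P"] conjI allI impI)
    fix j assume j: "j \<noteq> Suc (length P)"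
    show "prefix_minima n v j = prefix_minima n w j"
    proof (cases "j \<le> length P")
      case True
      then show ?thesis using vw by (simp add: prefix_minima_def)
    next
      case False
      define k where "k = j - length P - 2"
      have k: "j = length P + Suc (Suc k)" using j False by (simp add: k_def)
      have "set (take j v) = insert x (insert y (set P \<union> set (take k Q)))"
        "set (take j w) = insert x' (insert y' (set P \<union> set (take k Q)))"
        using k vw by auto
      then show ?thesis
        using eq[of "set P \<union> set (take k Q)"] by (simp only: prefix_minima_def minima_def)
    qed
  qed (use vw in simp)
  have "\<exists>i. (\<forall>j. j \<noteq> Suc i \<longrightarrow> prefix_minima n v j = prefix_minima n w j) \<and> Suc i < length v"
    using assms(1)
  proof cases
    case (left P x y Q)
    have "x \<in> transpositions_on S" "y \<in> transpositions_on S" using left assms(2) by auto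
    then show ?thesis
      using main[OF left] links_conj_by_eq[of y S x] by (simp add: insert_commute)
  next
    case (right P x y Q)
    have "x \<in> transpositions_on S" "y \<in> transpositions_on S" using right assms(2) by auto
    then show ?thesis
      using main[OF right] links_conj_by_eq[of x S y] by (simp add: insert_commute)
  qed
  then show ?thesis using that by blast
qed

text \<open>
  Reading a factorization of the long cycle from left to right, the points \<open>2, \<dots>, n\<close> cease to be
  least in their components one after the other. The pair \<open>(x, y)\<close> records that \<open>x\<close> does so before
  \<open>y\<close>; two factorizations are compared by the inversions between their two orders.
\<close>

definition elimination_pairs :: "nat \<Rightarrow> nat perm list \<Rightarrow> (nat \<times> nat) set" where
  "elimination_pairs n w =
    {(x, y). x \<in> {2..n} \<and> y \<in> {2..n} \<and> (\<exists>j. x \<notin> prefix_minima n w j \<and> y \<in> prefix_minima n w j)}"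

lemma finite_elimination_pairs: "finite (elimination_pairs n w)"
  by (rule finite_subset[of _ "{2..n} \<times> {2..n}"]) (auto simp: elimination_pairs_def)

lemma prefix_minima_Suc_unique:
  assumes "set w \<subseteq> transpositions_on S"
    "x \<in> prefix_minima n w j - prefix_minima n w (Suc j)"
    "y \<in> prefix_minima n w j - prefix_minima n w (Suc j)"
  shows "x = y"
proof (cases "j < length w")
  case True
  then have "set (take (Suc j) w) = insert (w ! j) (set (take j w))"
    by (simp add: take_Suc_conv_app_nth)
  moreover have "w ! j \<in> transpositions_on S" using True assms(1) nth_mem by blast
  ultimately show ?thesis
    using minima_insert_unique[of "w ! j" S x "{1..n}" "set (take j w)" y] assms(2,3)
    by (simp add: prefix_minima_def)
next
  case False
  then show ?thesis using assms by (simp add: prefix_minima_def)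
qed

text \<open>
  A move alters a single prefix, so it can at most exchange two consecutive entries of the
  elimination order: a pair that is lost consists of the points eliminated by the last letter of that
  prefix and by the letter after it.
\<close>

lemma elimination_pairs_move:
  assumes "hurwitz_move v w" "set v \<subseteq> transpositions_on S"
  shows "card (elimination_pairs n v - elimination_pairs n w) \<le> 1"
proof -
  obtain i where i: "\<And>j. j \<noteq> Suc i \<Longrightarrow> prefix_minima n v j = prefix_minima n w j"
    using prefix_minima_move[OF assms] by metis
  have steps: "x \<in> prefix_minima n v i - prefix_minima n v (Suc i) \<and>
      y \<in> prefix_minima n v (Suc i) - prefix_minima n v (Suc (Suc i))"
    if xy: "(x, y) \<in> elimination_pairs n v - elimination_pairs n w" for x y
  proof -
    obtain j where j: "x \<notin> prefix_minima n v j" "y \<in> prefix_minima n v j"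
      using xy by (auto simp: elimination_pairs_def)
    have other: "x \<in> prefix_minima n v k \<or> y \<notin> prefix_minima n v k" if "k \<noteq> Suc i" for k
      using xy i[OF that] by (auto simp: elimination_pairs_def)
    have "j = Suc i" using other j by blast
    then have "y \<in> prefix_minima n v i" using j prefix_minima_antimono[of i "Suc i" n v] by auto
    then have "x \<in> prefix_minima n v i" using other[of i] by simp
    moreover have "x \<notin> prefix_minima n v (Suc (Suc i))"
      using j \<open>j = Suc i\<close> prefix_minima_antimono[of "Suc i" "Suc (Suc i)" n v] by auto
    then have "y \<notin> prefix_minima n v (Suc (Suc i))" using other[of "Suc (Suc i)"] by simp
    ultimately show ?thesis using j \<open>j = Suc i\<close> by simp
  qed
  have "p = q" if "p \<in> elimination_pairs n v - elimination_pairs n w"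
    "q \<in> elimination_pairs n v - elimination_pairs n w" for p q
    using steps[of "fst p" "snd p"] steps[of "fst q" "snd q"] that
      prefix_minima_Suc_unique[OF assms(2)] by (metis prod.collapse)
  then show ?thesis
    using finite_elimination_pairs by (subst One_nat_def, subst card_le_Suc0_iff_eq) auto
qed

lemma elimination_pairs_moves:
  assumes "(hurwitz_move ^^ k) v w" "set v \<subseteq> transpositions_on S"
  shows "card (elimination_pairs n v - elimination_pairs n w) \<le> k"
  using assms(1)
proof (induction k arbitrary: w)
  case (Suc k)
  then obtain u where u: "(hurwitz_move ^^ k) v u" "hurwitz_move u w" by auto
  then have "set u \<subseteq> transpositions_on S"
    using within_moves_invariants[of k v u S] assms(2) by (auto simp: within_moves_def)
  then have "card (elimination_pairs n u - elimination_pairs n w) \<le> 1"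
    using elimination_pairs_move u(2) by blast
  moreover have "card (elimination_pairs n v - elimination_pairs n w)
      \<le> card ((elimination_pairs n v - elimination_pairs n u) \<union> (elimination_pairs n u - elimination_pairs n w))"
    using finite_elimination_pairs by (intro card_mono) auto
  moreover note card_Un_le[of "elimination_pairs n v - elimination_pairs n u"
      "elimination_pairs n u - elimination_pairs n w"]
  ultimately show ?case using Suc.IH[OF u(1)] by linarith
qed simp

lemma transpositions_eq: "transpositions n = transpositions_on {1..n}"
  by (simp add: transpositions_def transpositions_on_def)

text \<open>
  The empty prefix has \<open>n\<close> components, the whole word has one, and each of the \<open>n - 1\<close> letters
  removes at most one least point. So each letter removes exactly one.
\<close>

lemma elimination_order:
  assumes "w \<in> factorizations n" "n \<ge> 1"
  obtains xs where "distinct xs" "set xs = {2..n}"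
    "\<And>j. prefix_minima n w j = {1..n} - set (take j xs)"
proof -
  have len: "length w = n - 1" and S: "set w \<subseteq> transpositions_on {1..n}"
    and prod: "prod_list w = \<langle>[1..<Suc n]\<rangle>"
    using assms(1) by (auto simp: factorizations_def transpositions_eq long_cycle_def)
  have fin: "finite (prefix_minima n w j)" for j
    unfolding prefix_minima_def using minima_subset finite_subset by blast
  have "x \<in> {1..n} \<Longrightarrow> y \<in> {1..n} \<Longrightarrow> (x, y) \<in> (links (set w))\<^sup>*" for x y
    by (rule cycle_connected[OF S prod]) auto
  then have last: "card (prefix_minima n w (n - 1)) \<le> 1"
    using card_minima_connected[of "{1..n}" "set w"] len by (simp add: prefix_minima_def)
  have upper: "card (prefix_minima n w j) \<le> n - j" if "j \<le> n - 1" for j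
  proof -
    have "set (take j w) \<union> set (drop j w) = set w" by (metis append_take_drop_id set_append)
    then have "card (prefix_minima n w j) \<le> card (prefix_minima n w (n - 1)) + length (drop j w)"
      using card_minima_append[of "drop j w" "{1..n}" "{1..n}" "set (take j w)"] S len
      by (auto simp: prefix_minima_def)
    then show ?thesis using last len that assms(2) by simp
  qed
  have lower: "n \<le> card (prefix_minima n w j) + j" if "j \<le> n - 1" for j
    using card_minima_append[of "take j w" "{1..n}" "{1..n}" "{}"] S len that set_take_subset[of j w]
    by (auto simp: prefix_minima_def)
  have card: "card (prefix_minima n w j) = n - j" if "j \<le> n - 1" for j
    using upper[OF that] lower[OF that] by simp
  have "\<exists>xs. length xs = k \<and> distinct xs \<and> set xs \<subseteq> {1..n} \<and>
      (\<forall>j\<le>k. prefix_minima n w j = {1..n} - set (take j xs))" if "k \<le> n - 1" for k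
    using that
  proof (induction k)
    case 0
    then show ?case by (simp add: prefix_minima_def)
  next
    case (Suc k)
    then obtain xs where xs: "length xs = k" "distinct xs" "set xs \<subseteq> {1..n}"
      "\<forall>j\<le>k. prefix_minima n w j = {1..n} - set (take j xs)" by auto
    have sub: "prefix_minima n w (Suc k) \<subseteq> prefix_minima n w k" by (rule prefix_minima_antimono) simp
    then have "card (prefix_minima n w k - prefix_minima n w (Suc k)) = 1"
      using card[of k] card[of "Suc k"] Suc.prems fin by (simp add: card_Diff_subset)
    then obtain z where z: "prefix_minima n w k - prefix_minima n w (Suc k) = {z}"
      by (rule card_1_singletonE)
    have k: "prefix_minima n w k = {1..n} - set xs" using xs by auto
    have "z \<in> {1..n} - set xs" using z k by blast
    moreover have "prefix_minima n w (Suc k) = {1..n} - set (xs @ [z])"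
      using z k sub by auto
    ultimately show ?case
      using xs by (intro exI[of _ "xs @ [z]"]) (auto simp: le_Suc_eq)
  qed
  then obtain xs where xs: "length xs = n - 1" "distinct xs" "set xs \<subseteq> {1..n}"
    "\<forall>j\<le>n - 1. prefix_minima n w j = {1..n} - set (take j xs)" by blast
  have "1 \<le> y" if "(1, y) \<in> (links (set w))\<^sup>*" for y
    using that
  proof (cases rule: rtranclE)
    case (step z)
    then have "\<langle>z \<leftrightarrow> y\<rangle> \<in> transpositions_on {1..n}" using S by (auto simp: links_def)
    then show ?thesis by simp
  qed simp
  then have "1 \<in> prefix_minima n w (n - 1)" using len assms(2) by (simp add: prefix_minima_def minima_def)
  then have "1 \<notin> set xs" using xs by simp
  have "set xs \<subseteq> {2..n}"
  proof
    fix x assume "x \<in> set xs"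
    then have "x \<in> {1..n}" "x \<noteq> 1" using xs(3) \<open>1 \<notin> set xs\<close> by blast+
    then show "x \<in> {2..n}" by simp
  qed
  then have "set xs = {2..n}" using xs(1,2) by (intro card_subset_eq) (simp_all add: distinct_card)
  moreover have "prefix_minima n w j = {1..n} - set (take j xs)" for j
  proof (cases "j \<le> n - 1")
    case False
    then have "take j w = take (n - 1) w" "take j xs = take (n - 1) xs" using len xs(1) by simp_all
    then show ?thesis using xs(4) by (simp add: prefix_minima_def)
  qed (use xs(4) in simp)
  ultimately show ?thesis using that xs(2) by blast
qed

lemma minima_insert_isolated:
  assumes "A \<subseteq> transpositions_on S" "N \<notin> S"
  shows "minima (insert N S) A = insert N (minima S A)"
proof -
  have "(N, y) \<in> (links A)\<^sup>* \<Longrightarrow> y = N" for y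
  proof (erule converse_rtranclE)
    fix z assume "(N, z) \<in> links A"
    then have "\<langle>N \<leftrightarrow> z\<rangle> \<in> transpositions_on S" using assms(1) by (auto simp: links_def)
    then show "y = N" using assms(2) by simp
  qed simp
  then show ?thesis by (auto simp: minima_def)
qed

lemma minima_insert_pendant:
  assumes "A \<subseteq> transpositions_on S" "q \<in> S" "\<And>x. x \<in> S \<Longrightarrow> x < N"
  shows "minima (insert N S) (insert \<langle>q \<leftrightarrow> N\<rangle> A) = minima S A"
proof -
  have "q \<noteq> N" using assms(2,3) by fastforce
  have N: "N \<notin> S" using assms(3) by blast
  let ?f = "\<lambda>x. if x = N then q else x"
  have links: "links (insert \<langle>q \<leftrightarrow> N\<rangle> A) = insert (q, N) (insert (N, q) (links A))"
    using \<open>q \<noteq> N\<close> by (rule links_insert_swap)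
  have retract: "(?f x, ?f y) \<in> (links A)\<^sup>*" if "(x, y) \<in> (links (insert \<langle>q \<leftrightarrow> N\<rangle> A))\<^sup>*" for x y
    using that
  proof (induction rule: rtrancl_induct)
    case (step y z)
    have "(y, z) \<in> links A \<Longrightarrow> y \<noteq> N \<and> z \<noteq> N"
      using assms(1) N by (auto simp: links_def)
    then have "(?f y, ?f z) \<in> (links A)\<^sup>*"
      using step.hyps(2) \<open>q \<noteq> N\<close> unfolding links by auto
    then show ?case using step.IH by (rule rtrancl_trans[rotated])
  qed simp
  show ?thesis
  proof (rule set_eqI)
    fix x
    show "x \<in> minima (insert N S) (insert \<langle>q \<leftrightarrow> N\<rangle> A) \<longleftrightarrow> x \<in> minima S A"
    proof (cases "x \<in> S")
      case False
      have "(N, q) \<in> (links (insert \<langle>q \<leftrightarrow> N\<rangle> A))\<^sup>*" unfolding links by auto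
      moreover have "q < N" using assms(2,3) by blast
      ultimately have "N \<notin> minima (insert N S) (insert \<langle>q \<leftrightarrow> N\<rangle> A)" by (auto simp: minima_def not_le)
      then show ?thesis using False by (auto simp: minima_def)
    next
      case True
      have "(\<forall>y. (x, y) \<in> (links (insert \<langle>q \<leftrightarrow> N\<rangle> A))\<^sup>* \<longrightarrow> x \<le> y) \<longleftrightarrow>
            (\<forall>y. (x, y) \<in> (links A)\<^sup>* \<longrightarrow> x \<le> y)"
      proof (intro iffI allI impI)
        fix y
        assume *: "\<forall>y. (x, y) \<in> (links (insert \<langle>q \<leftrightarrow> N\<rangle> A))\<^sup>* \<longrightarrow> x \<le> y" "(x, y) \<in> (links A)\<^sup>*"
        then show "x \<le> y" using links_mono[of A "insert \<langle>q \<leftrightarrow> N\<rangle> A"] by blast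
      next
        fix y
        assume *: "\<forall>y. (x, y) \<in> (links A)\<^sup>* \<longrightarrow> x \<le> y" "(x, y) \<in> (links (insert \<langle>q \<leftrightarrow> N\<rangle> A))\<^sup>*"
        show "x \<le> y"
          using retract[OF *(2)] *(1) True N assms(3)[OF True] by (cases "y = N") auto
      qed
      then show ?thesis using True by (auto simp: minima_def)
    qed
  qed
qed

lemma prod_list_in_set:
  assumes "set w \<subseteq> transpositions_on S" "x \<in> S"
  shows "prod_list w \<langle>$\<rangle> x \<in> S"
  using assms(1)
proof (induction w)
  case (Cons t w)
  obtain a b where "t = \<langle>a \<leftrightarrow> b\<rangle>" "a \<in> S" "b \<in> S"
    using Cons.prems by (auto elim: transpositions_onE)
  then have "y \<in> S \<Longrightarrow> t \<langle>$\<rangle> y \<in> S" for y by (cases "y = a"; cases "y = b") auto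
  then show ?case using Cons by (simp add: apply_times)
qed (use assms(2) in simp)

lemma prod_list_fixes:
  assumes "set w \<subseteq> transpositions_on S" "x \<notin> S"
  shows "prod_list w \<langle>$\<rangle> x = x"
  using assms(1)
proof (induction w)
  case (Cons t w)
  then obtain a b where "t = \<langle>a \<leftrightarrow> b\<rangle>" "a \<in> S" "b \<in> S"
    by (auto elim: transpositions_onE)
  then have "t \<langle>$\<rangle> x = x" using assms(2) by (metis apply_swap_same)
  then show ?case using Cons by (simp add: apply_times)
qed simp

text \<open>
  Take \<open>n\<close> out of the given order and factorize the cycle on \<open>1, \<dots>, n - 1\<close> accordingly, as \<open>P @ Q\<close>; then insert a letter
  \<open>\<langle>q \<leftrightarrow> n\<rangle>\<close> at the place that \<open>n\<close> had. This letter attaches \<open>n\<close>, which is larger than all other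
  points, and thus eliminates \<open>n\<close> and nothing else. The choice of \<open>q\<close> as the image of \<open>n - 1\<close> under
  the product of \<open>Q\<close> makes the new letter equal to \<open>\<langle>n - 1 \<leftrightarrow> n\<rangle>\<close> once it is moved to the end, which
  extends the cycle by \<open>n\<close>.
\<close>

lemma elimination_order_exists:
  assumes "distinct xs" "set xs = {2..n}" "n \<ge> 1"
  shows "\<exists>w \<in> factorizations n. \<forall>j. prefix_minima n w j = {1..n} - set (take j xs)"
  using assms(3,1,2)
proof (induction n arbitrary: xs rule: nat_induct_at_least)
  case base
  then have "xs = []" by simp
  then show ?case
    by (auto intro!: bexI[of _ "[]"] simp: factorizations_def long_cycle_def prefix_minima_def)
next
  case (Suc n xs)
  obtain \<alpha> \<beta> where xs: "xs = \<alpha> @ Suc n # \<beta>"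
    using Suc.prems(2) \<open>1 \<le> n\<close> by (metis Suc_1 Suc_le_mono atLeastAtMost_iff le_refl split_list)
  have "set (\<alpha> @ \<beta>) = {2..Suc n} - {Suc n}" using Suc.prems xs by auto
  moreover have "{2..Suc n} - {Suc n} = {2..n}" by auto
  ultimately have seteq: "set (\<alpha> @ \<beta>) = {2..n}" by (rule trans)
  have dist: "distinct (\<alpha> @ \<beta>)" using Suc.prems xs by auto
  obtain w where w: "w \<in> factorizations n"
    "\<And>j. prefix_minima n w j = {1..n} - set (take j (\<alpha> @ \<beta>))"
    using Suc.IH[OF dist seteq] by blast
  have len: "length w = n - 1" and S: "set w \<subseteq> transpositions_on {1..n}"
    and prod: "prod_list w = \<langle>[1..<Suc n]\<rangle>"
    using w(1) by (auto simp: factorizations_def transpositions_eq long_cycle_def)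
  have "length (\<alpha> @ \<beta>) = n - 1"
    using distinct_card[OF dist] seteq by simp
  define P Q where "P = take (length \<alpha>) w" and "Q = drop (length \<alpha>) w"
  have wPQ: "w = P @ Q" and lenP: "length P = length \<alpha>"
    using len \<open>length (\<alpha> @ \<beta>) = n - 1\<close> by (auto simp: P_def Q_def)
  have PS: "set P \<subseteq> transpositions_on {1..n}" and QS: "set Q \<subseteq> transpositions_on {1..n}"
    using S wPQ by auto
  define q where "q = prod_list Q \<langle>$\<rangle> n"
  have q: "q \<in> {1..n}" using prod_list_in_set[OF QS, of n] \<open>1 \<le> n\<close> q_def by simp
  define v where "v = P @ [\<langle>q \<leftrightarrow> Suc n\<rangle>] @ Q"
  have S': "set v \<subseteq> transpositions_on {1..Suc n}"
    using PS QS q transpositions_on_mono[of "{1..n}" "{1..Suc n}"] unfolding v_def by auto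
  have "prod_list v = prod_list P * (\<langle>q \<leftrightarrow> Suc n\<rangle> * prod_list Q)" by (simp add: v_def)
  also have "\<langle>q \<leftrightarrow> Suc n\<rangle> * prod_list Q = prod_list Q * \<langle>n \<leftrightarrow> Suc n\<rangle>"
    using mult_swap[of "prod_list Q" n "Suc n"] prod_list_fixes[OF QS, of "Suc n"] q_def by simp
  also have "prod_list P * (prod_list Q * \<langle>n \<leftrightarrow> Suc n\<rangle>) = \<langle>[1..<Suc n]\<rangle> * \<langle>n \<leftrightarrow> Suc n\<rangle>"
    using prod unfolding wPQ by (simp only: prod_list.append mult.assoc[symmetric])
  also have "\<dots> = long_cycle (Suc n)"
    using cycle_insert_after[of "[1..<n]" n "Suc n" "[]"] \<open>1 \<le> n\<close> by (simp add: long_cycle_def)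
  finally have "v \<in> factorizations (Suc n)"
    using S' len wPQ \<open>1 \<le> n\<close> by (simp add: factorizations_def transpositions_eq v_def)
  moreover have "prefix_minima (Suc n) v j = {1..Suc n} - set (take j xs)" for j
  proof -
    have ins: "{1..Suc n} = insert (Suc n) {1..n}" using \<open>1 \<le> n\<close> by auto
    show ?thesis
    proof (cases "j \<le> length \<alpha>")
      case True
      then have "take j v = take j w" "take j (\<alpha> @ \<beta>) = take j xs"
        using lenP xs wPQ by (auto simp: v_def)
      moreover have "set (take j w) \<subseteq> transpositions_on {1..n}" using S set_take_subset by fast
      ultimately have "prefix_minima (Suc n) v j = insert (Suc n) ({1..n} - set (take j xs))"
        using minima_insert_isolated[of "set (take j w)" "{1..n}" "Suc n"] w(2)[of j] ins
        by (simp add: prefix_minima_def)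
      moreover have "Suc n \<notin> set (take j xs)"
      proof -
        have "take j xs = take j \<alpha>" using True xs by simp
        then show ?thesis using Suc.prems(1) xs by (auto dest: in_set_takeD)
      qed
      ultimately show ?thesis using ins by auto
    next
      case False
      define k where "k = j - length \<alpha> - 1"
      have k: "j = length \<alpha> + Suc k" using False by (simp add: k_def)
      have "set (take j v) = insert \<langle>q \<leftrightarrow> Suc n\<rangle> (set (take (length \<alpha> + k) w))"
        using k lenP wPQ by (simp add: v_def)
      moreover have "set (take (length \<alpha> + k) w) \<subseteq> transpositions_on {1..n}"
        using S set_take_subset by fast
      ultimately have "prefix_minima (Suc n) v j = {1..n} - set (take (length \<alpha> + k) (\<alpha> @ \<beta>))"
        using minima_insert_pendant[of "set (take (length \<alpha> + k) w)" "{1..n}" q "Suc n"] q ins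
          w(2)[of "length \<alpha> + k"]
        by (simp add: prefix_minima_def)
      also have "\<dots> = {1..Suc n} - set (take j xs)" using k xs ins by auto
      finally show ?thesis .
    qed
  qed
  ultimately show ?case by blast
qed

text \<open>
  A factorization whose elimination order is the reverse of that of \<open>v\<close> differs from \<open>v\<close> in all
  \<open>(n - 1) choose 2\<close> pairs, and every move mends at most one of them.
\<close>

lemma distant_factorization:
  assumes v: "v \<in> factorizations n" and n: "n \<ge> 1"
  shows "\<exists>u \<in> factorizations n. \<forall>k. (hurwitz_move ^^ k) v u \<longrightarrow> (n - 1) choose 2 \<le> k"
proof -
  obtain xs where xs: "distinct xs" "set xs = {2..n}"
    "\<And>j. prefix_minima n v j = {1..n} - set (take j xs)"
    using elimination_order[OF assms] by metis
  obtain u where u: "u \<in> factorizations n"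
    "\<And>j. prefix_minima n u j = {1..n} - set (take j (rev xs))"
    using elimination_order_exists[of "rev xs" n] xs n by auto
  let ?E = "elimination_pairs n"
  have "?E v \<inter> ?E u = {}"
  proof (rule equals0I, clarify)
    fix x y assume "(x, y) \<in> ?E v" "(x, y) \<in> ?E u"
    then obtain i j where xy: "y \<in> {2..n}"
      and i: "x \<in> set (take i xs)" "y \<notin> set (take i xs)"
      and j: "x \<in> set (take j (rev xs))" "y \<notin> set (take j (rev xs))"
      by (auto simp: elimination_pairs_def xs(3) u(2))
    have "set (take j (rev xs)) = set (drop (length xs - j) xs)"
      by (simp add: take_rev)
    moreover have "y \<in> set (take (length xs - j) xs) \<union> set (drop (length xs - j) xs)"
      using xy xs(2) by (metis append_take_drop_id set_append)
    ultimately have "x \<in> set (drop (length xs - j) xs)" "y \<in> set (take (length xs - j) xs)"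
      using j by blast+
    moreover have "set (take (length xs - j) xs) \<subseteq> set (take i xs) \<or>
        set (take i xs) \<subseteq> set (take (length xs - j) xs)"
      by (metis nle_le set_take_subset_set_take)
    ultimately show False
      using i set_take_disj_set_drop_if_distinct[OF xs(1), of "length xs - j" "length xs - j"] by blast
  qed
  then have diff: "?E v - ?E u = ?E v" by blast
  have "{2..n} \<times> {2..n} - Id \<subseteq> ?E v \<union> (?E v)\<inverse>"
  proof (rule subrelI)
    fix x y
    assume "(x, y) \<in> {2..n} \<times> {2..n} - Id"
    then have xy: "x \<in> set xs" "y \<in> set xs" "x \<noteq> y" using xs(2) by auto
    obtain k l where kl: "k < length xs" "xs ! k = x" "l < length xs" "xs ! l = y"
      using xy by (metis in_set_conv_nth)
    have pos: "xs ! i \<in> set (take m xs) \<longleftrightarrow> i < m" if "i < length xs" for i m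
      using that xs(1) by (auto simp: in_set_conv_nth nth_eq_iff_index_eq)
    have "(xs ! i, xs ! m) \<in> ?E v" if "i < m" "m < length xs" for i m
      using that pos[of i m] pos[of m m] xs(2) nth_mem[of i xs] nth_mem[of m xs]
      by (auto simp: elimination_pairs_def xs(3) intro!: exI[of _ m])
    then have "(x, y) \<in> ?E v \<or> (y, x) \<in> ?E v"
      using kl xy(3) by (metis linorder_neqE_nat)
    then show "(x, y) \<in> ?E v \<union> (?E v)\<inverse>" by blast
  qed
  then have "card ({2..n} \<times> {2..n} - Id) \<le> card (?E v \<union> (?E v)\<inverse>)"
    by (intro card_mono) (simp_all add: finite_elimination_pairs)
  also have "\<dots> \<le> 2 * card (?E v)"
    using card_Un_le[of "?E v" "(?E v)\<inverse>"] by (simp add: card_inverse)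
  finally have "card ({2..n} \<times> {2..n} - Id) \<le> 2 * card (?E v)" .
  moreover have "card ({2..n} \<times> {2..n} - Id) = (n - 1) * (n - 2)"
  proof -
    have "{2..n} \<times> {2..n} - Id = {2..n} \<times> {2..n} - (\<lambda>x. (x, x)) ` {2..n}" by auto
    also have "card \<dots> = (n - 1) * (n - 1) - (n - 1)"
      by (subst card_Diff_subset) (auto simp: card_image inj_on_def card_cartesian_product)
    also have "\<dots> = (n - 1) * (n - 2)" by (simp add: diff_mult_distrib2)
    finally show ?thesis .
  qed
  moreover have "(n - 1) choose 2 = (n - 1) * (n - 2) div 2"
    using choose_two[of "n - 1"] by (simp add: numeral_2_eq_2)
  ultimately have "(n - 1) choose 2 \<le> card (?E v)" by linarith
  then have "(hurwitz_move ^^ k) v u \<longrightarrow> (n - 1) choose 2 \<le> k" for k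
    using elimination_pairs_moves[of k v u "{1..n}" n] diff v
    by (auto simp: factorizations_def transpositions_eq)
  then show ?thesis using u(1) by blast
qed

section \<open>Non-crossing trees\<close>

text \<open>
  Acyclicity is expressed by saying that every edge is a bridge; this form passes to subgraphs
  immediately.
\<close>

definition tree_on :: "'a set \<Rightarrow> 'a rel \<Rightarrow> bool" where
  "tree_on S E \<longleftrightarrow> E \<subseteq> S \<times> S \<and> sym E \<and> irrefl E \<and>
     (\<forall>x\<in>S. \<forall>y\<in>S. (x, y) \<in> E\<^sup>*) \<and>
     (\<forall>a b. (a, b) \<in> E \<longrightarrow> (a, b) \<notin> (E - {(a, b), (b, a)})\<^sup>*)"

definition leaf_of :: "'a rel \<Rightarrow> 'a \<Rightarrow> 'a \<Rightarrow> bool" where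
  "leaf_of E v p \<longleftrightarrow> (\<forall>y. (v, y) \<in> E \<longleftrightarrow> y = p)"

lemma tree_on_restrict:
  assumes "tree_on S E" "I \<subseteq> S" "\<And>x y. x \<in> I \<Longrightarrow> y \<in> I \<Longrightarrow> (x, y) \<in> (E \<inter> I \<times> I)\<^sup>*"
  shows "tree_on I (E \<inter> I \<times> I)"
proof -
  have "(a, b) \<notin> (E \<inter> I \<times> I - {(a, b), (b, a)})\<^sup>*" if "(a, b) \<in> E" for a b
  proof -
    have "(E \<inter> I \<times> I - {(a, b), (b, a)})\<^sup>* \<subseteq> (E - {(a, b), (b, a)})\<^sup>*"
      by (intro rtrancl_mono) blast
    then show ?thesis using assms(1) that by (auto simp: tree_on_def)
  qed
  then show ?thesis
    using assms unfolding tree_on_def sym_def irrefl_def by blast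
qed

lemma leaving_edge:
  assumes "(m, x) \<in> E\<^sup>*" "m \<in> A" "x \<notin> A"
  shows "\<exists>p q. (p, q) \<in> E \<and> p \<in> A \<and> q \<notin> A"
  using assms by (induction rule: rtrancl_induct) auto

text \<open>
  Let \<open>A\<close> be a maximal proper connected vertex set containing \<open>m\<close>. An edge leaving \<open>A\<close> enlarges it,
  so by maximality its end \<open>v\<close> is the only vertex outside \<open>A\<close>. A second edge at \<open>v\<close> would lead back
  into \<open>A\<close> and close a cycle.
\<close>

lemma leaf_exists:
  assumes T: "tree_on S E" and "finite S" "m \<in> S" "S \<noteq> {m}"
  shows "\<exists>v\<in>S - {m}. \<exists>p. leaf_of E v p"
proof -
  define C where "C = {A. A \<subset> S \<and> m \<in> A \<and> (\<forall>a\<in>A. (m, a) \<in> (E \<inter> A \<times> A)\<^sup>*)}"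
  have "finite C" unfolding C_def using \<open>finite S\<close>
    by (rule_tac finite_subset[of _ "Pow S"]) auto
  moreover have "{m} \<in> C" using assms by (auto simp: C_def)
  ultimately obtain A where A: "A \<in> C" "\<And>B. B \<in> C \<Longrightarrow> A \<subseteq> B \<Longrightarrow> B = A"
    using finite_has_maximal[of C] by (metis empty_iff)
  obtain x where "x \<in> S" "x \<notin> A" using A(1) by (auto simp: C_def)
  moreover have m: "m \<in> A" using A(1) by (simp add: C_def)
  ultimately obtain p v where pv: "(p, v) \<in> E" "p \<in> A" "v \<notin> A"
    using leaving_edge[of m x E A] T \<open>m \<in> S\<close> by (auto simp: tree_on_def)
  have sym: "(b, a) \<in> E" if "(a, b) \<in> E" for a b using T that by (auto simp: tree_on_def sym_def)
  have ES: "E \<subseteq> S \<times> S" using T by (simp add: tree_on_def)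
  have conn: "(m, a) \<in> (E \<inter> A \<times> A)\<^sup>*" if "a \<in> A" for a using A(1) that by (auto simp: C_def)
  let ?B = "insert v A"
  have "(m, a) \<in> (E \<inter> ?B \<times> ?B)\<^sup>*" if "a \<in> A" for a
    using conn[OF that] rtrancl_mono[of "E \<inter> A \<times> A" "E \<inter> ?B \<times> ?B"] by blast
  moreover have "(p, v) \<in> E \<inter> ?B \<times> ?B" using pv by auto
  ultimately have "\<forall>a\<in>?B. (m, a) \<in> (E \<inter> ?B \<times> ?B)\<^sup>*"
    using pv(2) by (metis insertE rtrancl.rtrancl_into_rtrancl)
  moreover have "?B \<subseteq> S" using A(1) pv(1) ES by (auto simp: C_def)
  ultimately have S: "S = ?B"
    using A(2)[of ?B] pv(3) m by (auto simp: C_def)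
  have "y = p" if y: "(v, y) \<in> E" for y
  proof (rule ccontr)
    assume "y \<noteq> p"
    let ?E' = "E - {(p, v), (v, p)}"
    have "y \<noteq> v" using T y by (auto simp: tree_on_def irrefl_def)
    then have "y \<in> A" using ES y S by auto
    have sub: "(E \<inter> A \<times> A)\<^sup>* \<subseteq> ?E'\<^sup>*" using pv by (intro rtrancl_mono) auto
    have "sym (E \<inter> A \<times> A)" using sym by (auto simp: sym_def)
    then have "(p, m) \<in> (E \<inter> A \<times> A)\<^sup>*" using conn[OF pv(2)] by (metis sym_rtrancl symD)
    then have "(p, y) \<in> ?E'\<^sup>*" using conn[OF \<open>y \<in> A\<close>] sub by (meson rtrancl_trans subsetD)
    moreover have "(y, v) \<in> ?E'" using sym[OF y] \<open>y \<noteq> p\<close> \<open>y \<noteq> v\<close> by auto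
    ultimately have "(p, v) \<in> ?E'\<^sup>*" by (rule rtrancl_into_rtrancl)
    then show False using T pv(1) by (auto simp: tree_on_def)
  qed
  then have "leaf_of E v p" unfolding leaf_of_def using sym[OF pv(1)] by blast
  then show ?thesis using S m pv(3) by blast
qed

lemma tree_on_remove_leaf:
  assumes T: "tree_on S E" and leaf: "leaf_of E v p"
  defines "S' \<equiv> S - {v}"
  shows "tree_on S' (E \<inter> S' \<times> S')" "E = (E \<inter> S' \<times> S') \<union> {(v, p), (p, v)}"
proof -
  have vp: "(v, p) \<in> E" "\<And>y. (v, y) \<in> E \<Longrightarrow> y = p" using leaf by (auto simp: leaf_of_def)
  have sym: "(b, a) \<in> E" if "(a, b) \<in> E" for a b using T that by (auto simp: tree_on_def sym_def)
  have ES: "E \<subseteq> S \<times> S" using T by (simp add: tree_on_def)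
  have "p \<noteq> v" using T vp(1) by (auto simp: tree_on_def irrefl_def)
  then have "p \<in> S'" using vp(1) ES by (auto simp: S'_def)
  \<comment> \<open>Contracting the leaf to its neighbour turns paths of the tree into paths that avoid the leaf.\<close>
  let ?f = "\<lambda>x. if x = v then p else x"
  let ?E' = "E \<inter> S' \<times> S'"
  have "(?f x, ?f y) \<in> ?E'\<^sup>*" if "(x, y) \<in> E\<^sup>*" for x y
    using that
  proof (induction rule: rtrancl_induct)
    case (step y z)
    have "(?f y, ?f z) \<in> ?E'\<^sup>*"
    proof (cases "y = v \<or> z = v")
      case True
      then have "?f y = ?f z" using vp(2)[of z] vp(2)[of y] sym[of y z] step.hyps(2) by auto
      then show ?thesis by simp
    next
      case False
      then have "(y, z) \<in> ?E'" using step.hyps(2) ES by (auto simp: S'_def)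
      then show ?thesis using False by auto
    qed
    then show ?case using step.IH by (rule rtrancl_trans[rotated])
  qed simp
  then have "(x, y) \<in> ?E'\<^sup>*" if "x \<in> S'" "y \<in> S'" for x y
    using T that by (fastforce simp: tree_on_def S'_def)
  then show "tree_on S' ?E'"
    using T by (intro tree_on_restrict[OF T]) (auto simp: S'_def)
  show "E = ?E' \<union> {(v, p), (p, v)}"
    unfolding S'_def using vp sym ES by blast
qed

text \<open>
  Chords between points numbered along a circle cross if and only if their ends interleave.
\<close>

definition uncrossed :: "nat rel \<Rightarrow> bool" where
  "uncrossed E \<longleftrightarrow> (\<forall>a b c d. (a, b) \<in> E \<longrightarrow> (c, d) \<in> E \<longrightarrow> \<not> (a < c \<and> c < b \<and> b < d))"

lemma uncrossed_subset: "uncrossed E \<Longrightarrow> E' \<subseteq> E \<Longrightarrow> uncrossed E'"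
  unfolding uncrossed_def by blast

definition strictly_between :: "nat \<Rightarrow> nat \<Rightarrow> nat \<Rightarrow> bool" where
  "strictly_between a b x \<longleftrightarrow> min a b < x \<and> x < max a b"

text \<open>
  Choose a leaf \<open>l\<close> with neighbour \<open>m\<close> such that the two are as close as possible. Suppose that
  some vertices lie strictly between them. As no edge crosses \<open>(l, m)\<close> and \<open>l\<close> is a leaf, these
  vertices are joined to the rest of the tree through \<open>m\<close> only, so together with \<open>m\<close> they
  form a subtree. That subtree has a leaf other than \<open>m\<close>, which is also a leaf of the whole tree and is
  closer to its neighbour than \<open>l\<close> is to \<open>m\<close>.
\<close>

lemma consecutive_leaf_exists:
  assumes T: "tree_on S E" and fin: "finite S" and unc: "uncrossed E" and "card S \<ge> 2"
  obtains l m where "leaf_of E l m" "\<And>x. x \<in> S \<Longrightarrow> \<not> strictly_between l m x"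
proof -
  have ES: "E \<subseteq> S \<times> S" using T by (simp add: tree_on_def)
  have sym: "(b, a) \<in> E" if "(a, b) \<in> E" for a b using T that by (auto simp: tree_on_def sym_def)
  have "S \<noteq> {}" using \<open>card S \<ge> 2\<close> by (metis card.empty not_numeral_le_zero)
  then obtain r where "r \<in> S" by blast
  have "S \<noteq> {r}" using \<open>card S \<ge> 2\<close> by (rule_tac notI) simp
  then obtain l0 m0 where "leaf_of E l0 m0" using leaf_exists[OF T fin \<open>r \<in> S\<close>] by blast
  then obtain l m where lm: "leaf_of E l m"
    and least: "\<And>l' m'. leaf_of E l' m' \<Longrightarrow> max l m - min l m \<le> max l' m' - min l' m'"
    using ex_has_least_nat[of "\<lambda>(l, m). leaf_of E l m" "(l0, m0)" "\<lambda>(l, m). max l m - min l m"]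
    by fastforce
  have edge: "(l, m) \<in> E" "(m, l) \<in> E" using lm sym[of l m] by (simp_all add: leaf_of_def)
  show ?thesis
  proof (rule that[OF lm], rule notI)
    fix x assume "x \<in> S" and x: "strictly_between l m x"
    define I where "I = insert m {x \<in> S. strictly_between l m x}"
    have "I \<subseteq> S" using edge ES by (auto simp: I_def)
    have closed: "y \<in> I" if "strictly_between l m v" "(v, y) \<in> E" for v y
    proof -
      have "y \<in> S" using that(2) ES by auto
      have "y \<noteq> l" using sym[OF that(2)] lm that(1) by (auto simp: leaf_of_def strictly_between_def)
      have yv: "(y, v) \<in> E" using sym[OF that(2)] .
      have "\<not> (a < c \<and> c < b \<and> b < d)" if "(a, b) \<in> E" "(c, d) \<in> E" for a b c d
        using unc that by (auto simp: uncrossed_def)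
      from this[OF edge(1) that(2)] this[OF edge(2) that(2)] this[OF yv edge(1)] this[OF yv edge(2)]
      have "y = m \<or> strictly_between l m y"
        using that(1) \<open>y \<noteq> l\<close> by (auto simp: strictly_between_def min_def max_def split: if_splits)
      then show ?thesis using \<open>y \<in> S\<close> by (auto simp: I_def)
    qed
    let ?E = "E \<inter> I \<times> I"
    have to_m: "(v, m) \<in> ?E\<^sup>*" if "(v, m) \<in> E\<^sup>*" "v \<in> I" for v
      using that
    proof (induction rule: converse_rtrancl_induct)
      case (step v y)
      show ?case
      proof (cases "v = m")
        case False
        then have "y \<in> I" using closed step by (auto simp: I_def)
        then show ?thesis using step by (intro converse_rtrancl_into_rtrancl[of v y]) auto
      qed simp
    qed simp
    have symI: "sym ?E" using sym by (auto simp: sym_def)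
    have conn: "(v, w) \<in> ?E\<^sup>*" if "v \<in> I" "w \<in> I" for v w
    proof -
      have "(u, m) \<in> ?E\<^sup>*" if "u \<in> I" for u
        using to_m[of u] T that \<open>I \<subseteq> S\<close> by (auto simp: tree_on_def I_def)
      then show ?thesis using that symI by (meson rtrancl_trans sym_rtrancl symD)
    qed
    have "tree_on I ?E" using tree_on_restrict[OF T \<open>I \<subseteq> S\<close> conn] .
    moreover have "finite I" using \<open>I \<subseteq> S\<close> fin finite_subset by blast
    moreover have "I \<noteq> {m}" using \<open>x \<in> S\<close> x by (auto simp: I_def strictly_between_def)
    moreover have "m \<in> I" by (simp add: I_def)
    ultimately obtain v p where v: "v \<in> I" "v \<noteq> m" "leaf_of ?E v p"
      using leaf_exists[of I ?E m] by blast
    then have between: "strictly_between l m v" by (auto simp: I_def)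
    have "leaf_of E v p" using v closed[OF between] by (auto simp: leaf_of_def)
    then have "max l m - min l m \<le> max v p - min v p" by (rule least)
    moreover have "p \<in> I" using v(3) by (auto simp: leaf_of_def)
    ultimately show False
      using between by (auto simp: I_def strictly_between_def min_def max_def split: if_splits)
  qed
qed

lemma consecutive_in_sorted_list:
  fixes a b :: nat
  assumes "sorted_wrt (<) xs" "a \<in> set xs" "b \<in> set xs" "a < b" "\<And>x. x \<in> set xs \<Longrightarrow> \<not> (a < x \<and> x < b)"
  obtains \<alpha> \<beta> where "xs = \<alpha> @ a # b # \<beta>"
proof -
  obtain \<alpha> \<gamma> where \<gamma>: "xs = \<alpha> @ a # \<gamma>" using assms(2) by (metis split_list)
  then have "b \<in> set \<gamma>" using assms by (auto simp: sorted_wrt_append)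
  then obtain c \<beta> where c: "\<gamma> = c # \<beta>" by (cases \<gamma>) auto
  have "a < c" using assms(1) \<gamma> c by (auto simp: sorted_wrt_append)
  moreover have "c \<le> b" using assms(1) \<gamma> c \<open>b \<in> set \<gamma>\<close> by (auto simp: sorted_wrt_append)
  moreover have "c \<in> set xs" using \<gamma> c by simp
  ultimately have "c = b" using assms(5)[of c] by simp
  then show ?thesis using that \<gamma> c by blast
qed


section \<open>The upper bound\<close>

text \<open>
  If a letter involved \<open>a\<close>, the word would connect one point more than its length permits.
\<close>

lemma letters_of_minimal_factorization:
  fixes xs :: "nat list"
  assumes v: "set v \<subseteq> transpositions_on (insert a (set xs))" "prod_list v = \<langle>xs\<rangle>"
    "length v < length xs" and xs: "distinct xs" "a \<notin> set xs"
  shows "set v \<subseteq> transpositions_on (set xs)"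
proof
  fix t assume t: "t \<in> set v"
  then obtain c d where cd: "t = \<langle>c \<leftrightarrow> d\<rangle>" "c \<in> insert a (set xs)" "d \<in> insert a (set xs)" "c \<noteq> d"
    using v(1) by (meson subsetD transpositions_onE)
  have "(c, d) \<in> links (set v)" "(d, c) \<in> links (set v)"
    using t cd by (auto simp: links_def swap_sym)
  let ?R = "(links (set v))\<^sup>*"
  have xs_conn: "(x, y) \<in> ?R" if "x \<in> set xs" "y \<in> set xs" for x y
    using cycle_connected[OF v(1,2) xs(1) that] .
  show "t \<in> transpositions_on (set xs)"
  proof (rule ccontr)
    assume "t \<notin> transpositions_on (set xs)"
    then have "c = a \<or> d = a" using cd by auto
    then obtain b where b: "b \<in> set xs" "(a, b) \<in> ?R" "(b, a) \<in> ?R"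
      using cd \<open>(c, d) \<in> _\<close> \<open>(d, c) \<in> _\<close> by blast
    have "(x, b) \<in> ?R" "(b, x) \<in> ?R" if "x \<in> insert a (set xs)" for x
      using b xs_conn that by blast+
    then have "card (insert a (set xs)) \<le> length v + 1"
      by (intro connecting_word_length[OF v(1)]) (blast intro: rtrancl_trans)+
    then show False using v(3) xs by (simp add: distinct_card)
  qed
qed

text \<open>
  Let the leaf \<open>l\<close> and its neighbour \<open>m\<close> be the consecutive entries \<open>a < b\<close> of \<open>xs\<close>. If \<open>l\<close> is \<open>a\<close>,
  then \<open>\<langle>a \<leftrightarrow> b\<rangle>\<close> times the cycle is the cycle with \<open>a\<close> removed, so \<open>\<langle>a \<leftrightarrow> b\<rangle>\<close> followed by a word for
  the tree without \<open>l\<close> is a word for the whole tree. If \<open>l\<close> is \<open>b\<close>, the new letter goes to the end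
  instead. As the cycle maps \<open>a\<close> to \<open>b\<close>, in every other factorization this letter can be brought to
  the same end by \<open>length xs - 2\<close> moves, and induction finishes the remaining word. The bounds add up:
  \<open>k + (k choose 2) = (k + 1) choose 2\<close>.
\<close>

lemma central_word_exists:
  fixes xs :: "nat list"
  assumes "sorted_wrt (<) xs" "xs \<noteq> []" "tree_on (set xs) E" "uncrossed E"
  shows "\<exists>w. set w = {\<langle>a \<leftrightarrow> b\<rangle> | a b. (a, b) \<in> E} \<and> length w = length xs - 1 \<and> prod_list w = \<langle>xs\<rangle> \<and>
    (\<forall>u. length u = length xs - 1 \<longrightarrow> set u \<subseteq> transpositions_on (set xs) \<longrightarrow> prod_list u = \<langle>xs\<rangle> \<longrightarrow>
       within_moves ((length xs - 1) choose 2) u w)"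
  using assms
proof (induction "length xs" arbitrary: xs E rule: less_induct)
  case less
  have ES: "E \<subseteq> set xs \<times> set xs" using less.prems(3) by (simp add: tree_on_def)
  have dist: "distinct xs" using less.prems(1) strict_sorted_iff by blast
  show ?case
  proof (cases "length xs = 1")
    case True
    then obtain x where x: "xs = [x]" by (cases xs) auto
    then have "E = {}" using ES less.prems(3) by (auto simp: tree_on_def irrefl_def)
    then show ?thesis using x by (intro exI[of _ "[]"]) auto
  next
    case False
    then have len: "length xs \<ge> 2" using less.prems(2) by (cases xs) (auto simp: Suc_le_eq)
    have "card (set xs) \<ge> 2" using len dist by (simp add: distinct_card)
    then obtain l m where lm: "leaf_of E l m" and gap: "\<And>x. x \<in> set xs \<Longrightarrow> \<not> strictly_between l m x"
      using consecutive_leaf_exists[OF less.prems(3) _ less.prems(4)] by (metis List.finite_set)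
    define a b where "a = min l m" and "b = max l m"
    have lm_in: "(l, m) \<in> E" using lm by (simp add: leaf_of_def)
    then have "l \<noteq> m" using less.prems(3) by (auto simp: tree_on_def irrefl_def)
    have ab: "a < b" "a \<in> set xs" "b \<in> set xs" "{a, b} = {l, m}"
      using \<open>l \<noteq> m\<close> lm_in ES by (auto simp: a_def b_def min_def max_def)
    obtain \<alpha> \<beta> where xs: "xs = \<alpha> @ a # b # \<beta>"
      using consecutive_in_sorted_list[OF less.prems(1) ab(2,3,1)] gap
      by (auto simp: strictly_between_def a_def b_def)
    define ys where "ys = (if l = a then \<alpha> @ b # \<beta> else \<alpha> @ a # \<beta>)"
    define E' where "E' = E \<inter> (set xs - {l}) \<times> (set xs - {l})"
    have la: "l = a \<or> l = b" using ab(4) by auto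
    have ys: "set ys = set xs - {l}" "length xs = Suc (length ys)" "ys \<noteq> []" "sorted_wrt (<) ys"
      using xs dist la ab(1) less.prems(1) by (auto simp: ys_def sorted_wrt_append)
    have E': "tree_on (set ys) E'" "E = E' \<union> {(l, m), (m, l)}"
      using tree_on_remove_leaf[OF less.prems(3) lm] by (simp_all add: E'_def ys(1))
    have "uncrossed E'" using less.prems(4) uncrossed_subset E'(2) by blast
    then obtain w where w: "set w = {\<langle>a \<leftrightarrow> b\<rangle> | a b. (a, b) \<in> E'}" "length w = length ys - 1"
      "prod_list w = \<langle>ys\<rangle>"
      "\<And>u. length u = length ys - 1 \<Longrightarrow> set u \<subseteq> transpositions_on (set ys) \<Longrightarrow> prod_list u = \<langle>ys\<rangle> \<Longrightarrow>
         within_moves ((length ys - 1) choose 2) u w"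
      using less.hyps[of ys E'] ys E'(1) by auto
    let ?t = "\<langle>a \<leftrightarrow> b\<rangle>"
    have t: "?t = \<langle>l \<leftrightarrow> m\<rangle>" using ab by (simp add: swap_eq_iff)
    have letters: "insert ?t (set w) = {\<langle>a \<leftrightarrow> b\<rangle> | a b. (a, b) \<in> E}"
      unfolding w(1) E'(2) t by (auto simp: swap_sym)
    have next_a: "\<langle>xs\<rangle> \<langle>$\<rangle> a = b" using cycle_apply_next[of \<alpha> a b \<beta>] dist xs by simp
    have bound: "(length xs - 1) choose 2 = (length ys - 1) + ((length ys - 1) choose 2)"
      using ys(2,3) by (cases ys) (simp_all add: numeral_2_eq_2)
    have extend: "set v \<subseteq> transpositions_on (set ys)"
      if "set v \<subseteq> transpositions_on (set xs)" "prod_list v = \<langle>ys\<rangle>" "length v = length ys - 1" for v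
    proof (rule letters_of_minimal_factorization[of v l])
      have "insert l (set ys) = set xs" using ys(1) la ab by auto
      then show "set v \<subseteq> transpositions_on (insert l (set ys))" using that(1) by simp
      show "length v < length ys" using that(3) ys(3) by (cases ys) simp_all
      show "distinct ys" using ys(4) strict_sorted_iff by blast
      show "l \<notin> set ys" using ys(1) by blast
    qed (rule that(2))
    show ?thesis
    proof (cases "l = a")
      case True
      have prod: "?t * \<langle>xs\<rangle> = \<langle>ys\<rangle>"
        using swap_mult_cycle[of \<alpha> a b \<beta>] dist xs True by (simp add: ys_def)
      have "within_moves ((length xs - 1) choose 2) u (?t # w)"
        if u: "length u = length xs - 1" "set u \<subseteq> transpositions_on (set xs)" "prod_list u = \<langle>xs\<rangle>" for u
      proof -
        obtain v where v: "within_moves (length u - 1) u (?t # v)"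
          using move_to_front[of u a b] u next_a ab(1) transpositions_on_mono[of "set xs" UNIV] by auto
        have inv: "length (?t # v) = length u" "prod_list (?t # v) = prod_list u"
          "set (?t # v) \<subseteq> transpositions_on (set xs)"
          using within_moves_invariants[OF v u(2)] by blast+
        have "prod_list v = ?t * (?t * prod_list v)" by (simp add: mult.assoc[symmetric])
        then have "prod_list v = \<langle>ys\<rangle>" using inv(2) u(3) prod by simp
        then have "within_moves ((length ys - 1) choose 2) v w"
          using inv u(1) ys(2) by (intro w(4) extend) auto
        then have "within_moves (length u - 1 + ((length ys - 1) choose 2)) u (?t # w)"
          using within_moves_trans[OF v] within_moves_Cons by blast
        then show ?thesis using bound u(1) ys(2) by simp
      qed
      moreover have "prod_list (?t # w) = \<langle>xs\<rangle>"
        unfolding prod_list.Cons w(3) prod[symmetric] by (simp add: mult.assoc[symmetric])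
      ultimately show ?thesis
        using letters w(2) ys(2,3) by (intro exI[of _ "?t # w"]) (auto simp: Suc_diff_le)
    next
      case False
      have prod: "\<langle>xs\<rangle> * ?t = \<langle>ys\<rangle>"
        using cycle_mult_swap[of \<alpha> a b \<beta>] dist xs False by (simp add: ys_def)
      have "within_moves ((length xs - 1) choose 2) u (w @ [?t])"
        if u: "length u = length xs - 1" "set u \<subseteq> transpositions_on (set xs)" "prod_list u = \<langle>xs\<rangle>" for u
      proof -
        obtain v where v: "within_moves (length u - 1) u (v @ [?t])"
          using move_to_back[of u a b] u next_a ab(1) transpositions_on_mono[of "set xs" UNIV] by auto
        have inv: "length (v @ [?t]) = length u" "prod_list (v @ [?t]) = prod_list u"
          "set (v @ [?t]) \<subseteq> transpositions_on (set xs)"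
          using within_moves_invariants[OF v u(2)] by blast+
        have "prod_list v = (prod_list v * ?t) * ?t" by (simp add: mult.assoc)
        then have "prod_list v = \<langle>ys\<rangle>" using inv(2) u(3) prod by simp
        then have "within_moves ((length ys - 1) choose 2) v w"
          using inv u(1) ys(2) by (intro w(4) extend) auto
        then have "within_moves (length u - 1 + ((length ys - 1) choose 2)) u (w @ [?t])"
          using within_moves_trans[OF v] within_moves_append by blast
        then show ?thesis using bound u(1) ys(2) by simp
      qed
      moreover have "prod_list (w @ [?t]) = \<langle>xs\<rangle>"
        unfolding prod_list.append w(3) prod[symmetric] by (simp add: mult.assoc)
      ultimately show ?thesis
        using letters w(2) ys(2,3) by (intro exI[of _ "w @ [?t]"]) (auto simp: Suc_diff_le)
    qed
  qed
qed

section \<open>The Hurwitz graph\<close>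

lemma hurwitz_move_sym:
  assumes "hurwitz_move v w" "set v \<subseteq> transpositions_on S"
  shows "hurwitz_move w v"
proof -
  have cancel: "conj_by s (conj_by s t) = t" if "s \<in> transpositions_on S" for s t
  proof -
    have s: "inverse s = s" "s * s = 1" using that by (auto elim!: transpositions_onE)
    have "conj_by s (conj_by s t) = (s * s) * t * (s * s)" using s(1) by (simp add: conj_by_def mult.assoc)
    then show ?thesis using s(2) by simp
  qed
  show ?thesis
    using assms(1)
  proof cases
    case (left P x y Q)
    then show ?thesis
      using hurwitz_move.right[of P y "conj_by y x" Q] cancel[of y x] assms(2) by simp
  next
    case (right P x y Q)
    then show ?thesis
      using hurwitz_move.left[of P "conj_by x y" x Q] cancel[of x y] assms(2) by simp
  qed
qed

lemma hurwitz_moves_sym: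
  assumes "(hurwitz_move ^^ k) v w" "set v \<subseteq> transpositions_on S"
  shows "(hurwitz_move ^^ k) w v"
  using assms(1)
proof (induction k arbitrary: w)
  case (Suc k)
  then obtain u where u: "(hurwitz_move ^^ k) v u" "hurwitz_move u w" by auto
  then have "set u \<subseteq> transpositions_on S"
    using within_moves_invariants[of k v u S] assms(2) by (auto simp: within_moves_def)
  then have "hurwitz_move w u" using hurwitz_move_sym u(2) by blast
  then show ?case using Suc.IH[OF u(1)] by (rule relpowp_Suc_I2)
qed simp

lemma factorizationsD:
  assumes "w \<in> factorizations n"
  shows "length w = n - 1" "set w \<subseteq> transpositions_on {1..n}" "prod_list w = \<langle>[1..<Suc n]\<rangle>"
  using assms by (auto simp: factorizations_def transpositions_eq long_cycle_def)

lemma finite_factorizations: "finite (factorizations n)"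
proof -
  have "transpositions_on {1..n} \<subseteq> (\<lambda>(a, b). \<langle>a \<leftrightarrow> b\<rangle>) ` ({1..n} \<times> {1..n})"
    by (auto elim!: transpositions_onE)
  then have "finite (transpositions_on {1..n})" by (rule finite_subset) simp
  then have "finite {w. set w \<subseteq> transpositions_on {1..n} \<and> length w = n - 1}"
    by (rule finite_lists_length_eq)
  then show ?thesis
    by (rule finite_subset[rotated]) (use factorizationsD in blast)
qed

lemma hurwitz_move_factorizations:
  "hurwitz_move v w \<Longrightarrow> v \<in> factorizations n \<Longrightarrow> w \<in> factorizations n"
  using hurwitz_move_length[of v w] hurwitz_move_prod_list[of v w] hurwitz_move_letters[of v w]
  unfolding factorizations_def transpositions_eq by fastforce

lemma hurwitz_step_iff_move:
  assumes "length v = n - 1"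
  shows "hurwitz_step n v w \<longleftrightarrow> hurwitz_move v w"
proof
  assume "hurwitz_step n v w"
  then obtain i where i: "1 \<le> i" "i \<le> n - 2" "w = hurwitz_R i v \<or> w = hurwitz_L i v"
    unfolding hurwitz_step_def by blast
  define P x y Q where "P = take (i - 1) v" and "x = v ! (i - 1)" and "y = v ! i" and "Q = drop (Suc i) v"
  have "i < length v" using i assms by simp
  then have v: "v = P @ [x, y] @ Q"
    using i(1) unfolding P_def x_def y_def Q_def
    by (metis Cons_nth_drop_Suc Suc_diff_1 Suc_lessD append_Cons append_Nil append_take_drop_id less_eq_Suc_le One_nat_def)
  have P: "length P = i - 1" using \<open>i < length v\<close> by (simp add: P_def)
  have upd: "v[i - 1 := s, i := t] = P @ [s, t] @ Q" for s t
  proof -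
    have "i = Suc (length P)" using P i(1) by simp
    then show ?thesis unfolding v by (simp add: list_update_append)
  qed
  show "hurwitz_move v w"
    using i(3) hurwitz_move.intros[of P x y Q] unfolding hurwitz_R_def hurwitz_L_def upd
    by (metis v x_def y_def)
next
  assume "hurwitz_move v w"
  then show "hurwitz_step n v w"
  proof cases
    case (left P x y Q)
    then have "w = hurwitz_L (Suc (length P)) v"
      by (simp add: hurwitz_L_def list_update_append nth_append)
    then show ?thesis using assms left unfolding hurwitz_step_def by (intro exI[of _ "Suc (length P)"]) auto
  next
    case (right P x y Q)
    then have "w = hurwitz_R (Suc (length P)) v"
      by (simp add: hurwitz_R_def list_update_append nth_append)
    then show ?thesis using assms right unfolding hurwitz_step_def by (intro exI[of _ "Suc (length P)"]) auto
  qed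
qed

lemma pverts_hurwitz_graph: "pverts (hurwitz_graph n) = factorizations n"
  by (simp add: hurwitz_graph_def)

lemma parcs_hurwitz_graph:
  "parcs (hurwitz_graph n) = {(v, w). v \<in> factorizations n \<and> hurwitz_move v w}"
proof -
  have "hurwitz_step n v w \<or> hurwitz_step n w v \<longleftrightarrow> hurwitz_move v w"
    if "v \<in> factorizations n" "w \<in> factorizations n" for v w
    using that factorizationsD[of v n] factorizationsD[of w n] hurwitz_step_iff_move hurwitz_move_sym by blast
  then show ?thesis
    using hurwitz_move_factorizations unfolding hurwitz_graph_def pair_pre_digraph.simps by blast
qed

text \<open>
  A move that does nothing needs two equal neighbouring letters. Leaving out one of them would
  connect all points with fewer than \<open>n - 1\<close> letters.
\<close>

lemma hurwitz_move_irrefl: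
  assumes v: "v \<in> factorizations n"
  shows "\<not> hurwitz_move v v"
proof
  assume "hurwitz_move v v"
  then obtain P x Q where eq: "v = P @ [x, x] @ Q" by cases auto
  have "length v = n - 1" using v factorizationsD by blast
  then have n: "length (P @ [x] @ Q) + 1 < n" using eq by simp
  have S: "set v \<subseteq> transpositions_on {1..n}" using factorizationsD[OF v] by blast
  have same: "set v = set (P @ [x] @ Q)" using eq by auto
  have "(a, b) \<in> (links (set v))\<^sup>*" if "a \<in> {1..n}" "b \<in> {1..n}" for a b
    by (rule cycle_connected[OF factorizationsD(2,3)[OF v]]) (use that in auto)
  then have "card {1..n} \<le> length (P @ [x] @ Q) + 1"
    using S unfolding same by (intro connecting_word_length[of _ "{1..n}"] finite_atLeastAtMost) assumption+
  then show False using n by simp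
qed

lemma pair_graph_hurwitz_graph: "pair_graph (hurwitz_graph n)"
proof -
  have "finite (parcs (hurwitz_graph n))"
    by (rule finite_subset[of _ "factorizations n \<times> factorizations n"])
       (auto simp: parcs_hurwitz_graph finite_factorizations hurwitz_move_factorizations)
  moreover have "symmetric (with_proj (hurwitz_graph n))"
    unfolding symmetric_def with_proj_simps
  proof (rule symI)
    fix v w assume "(v, w) \<in> parcs (hurwitz_graph n)"
    then have v: "v \<in> factorizations n" and m: "hurwitz_move v w"
      by (simp_all add: parcs_hurwitz_graph)
    show "(w, v) \<in> parcs (hurwitz_graph n)"
      using hurwitz_move_sym[OF m factorizationsD(2)[OF v]] hurwitz_move_factorizations[OF m v]
      by (simp add: parcs_hurwitz_graph)
  qed
  ultimately show ?thesis
    by unfold_locales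
       (auto simp: pverts_hurwitz_graph parcs_hurwitz_graph finite_factorizations
         hurwitz_move_factorizations hurwitz_move_irrefl)
qed

context
  fixes n :: nat
begin

interpretation pair_graph "hurwitz_graph n"
  by (rule pair_graph_hurwitz_graph)

lemma moves_if_awalk: "awalk u p v \<Longrightarrow> (hurwitz_move ^^ length p) u v"
proof (induction p arbitrary: u)
  case (Cons e p)
  then have e: "e \<in> parcs (hurwitz_graph n)" "fst e = u" and p: "awalk (snd e) p v"
    by (auto simp: awalk_Cons_iff)
  have "hurwitz_move u (snd e)" using e by (auto simp: parcs_hurwitz_graph)
  then show ?case
    unfolding length_Cons using Cons.IH[OF p] by (rule relpowp_Suc_I2)
qed (simp add: awalk_Nil_iff)

lemma awalk_if_moves:
  "(hurwitz_move ^^ k) u v \<Longrightarrow> u \<in> factorizations n \<Longrightarrow> \<exists>p. awalk u p v \<and> length p = k"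
proof (induction k arbitrary: u)
  case 0
  then show ?case by (intro exI[of _ "[]"]) (simp add: awalk_Nil_iff pverts_hurwitz_graph)
next
  case (Suc k)
  then obtain w where w: "hurwitz_move u w" "(hurwitz_move ^^ k) w v" by (meson relpowp_Suc_D2)
  then have "w \<in> factorizations n" using Suc.prems hurwitz_move_factorizations by blast
  then obtain p where "awalk w p v" "length p = k" using Suc.IH w(2) by blast
  moreover have "(u, w) \<in> parcs (hurwitz_graph n)" using w Suc.prems by (simp add: parcs_hurwitz_graph)
  ultimately show ?case by (intro exI[of _ "(u, w) # p"]) (simp add: awalk_Cons_iff)
qed

lemma awalk_cost_1: "awalk_cost (\<lambda>_. 1) p = real (length p)"
  by (induction p) simp_all

lemma graph_dist_le:
  assumes "(hurwitz_move ^^ k) u v" "u \<in> factorizations n"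
  shows "graph_dist (hurwitz_graph n) u v \<le> ereal (real k)"
proof -
  obtain p where "awalk u p v" "length p = k" using awalk_if_moves[OF assms] by blast
  then show ?thesis
    using min_cost_le_walk_cost[of u p v "\<lambda>_. 1"] by (simp add: graph_dist_def awalk_cost_1)
qed

lemma graph_dist_ge:
  assumes "\<And>j. (hurwitz_move ^^ j) u v \<Longrightarrow> k \<le> j"
  shows "ereal (real k) \<le> graph_dist (hurwitz_graph n) u v"
  unfolding graph_dist_def \<mu>_def
  by (rule INF_greatest) (use assms moves_if_awalk in \<open>auto simp: awalk_cost_1\<close>)

text \<open>
  Some vertex is at distance at least \<open>(n - 1) choose 2\<close> from any given vertex. So a vertex from which
  nothing is farther than that has least eccentricity.
\<close>

lemma central_vertexI:
  assumes w: "w \<in> factorizations n" and n: "n \<ge> 1"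
    and reach: "\<And>u. u \<in> factorizations n \<Longrightarrow> within_moves ((n - 1) choose 2) u w"
  shows "central_vertex (hurwitz_graph n) w"
proof -
  let ?G = "hurwitz_graph n" and ?r = "ereal (real ((n - 1) choose 2))"
  have from_w: "\<exists>j \<le> (n - 1) choose 2. (hurwitz_move ^^ j) w u" if "u \<in> factorizations n" for u
    using reach[OF that] hurwitz_moves_sym factorizationsD(2)[OF that] unfolding within_moves_def by blast
  have "Digraph_Component.connected (with_proj ?G)"
    unfolding Digraph_Component.connected_def
  proof (rule strongly_connectedI)
    show "verts (mk_symmetric (with_proj ?G)) \<noteq> {}"
      using w by (auto simp: pverts_hurwitz_graph)
    fix u v assume "u \<in> verts (with_proj (mk_symmetric (with_proj ?G)))"
      "v \<in> verts (with_proj (mk_symmetric (with_proj ?G)))"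
    then have uv: "u \<in> factorizations n" "v \<in> factorizations n" by (simp_all add: pverts_hurwitz_graph)
    obtain i j where "(hurwitz_move ^^ i) u w" "(hurwitz_move ^^ j) w v"
      using reach[OF uv(1)] from_w[OF uv(2)] unfolding within_moves_def by blast
    then have "(hurwitz_move ^^ (i + j)) u v" by (auto simp: relpowp_add)
    then have "u \<rightarrow>\<^sup>*\<^bsub>with_proj ?G\<^esub> v"
      using awalk_if_moves uv(1) reachable_awalkI by blast
    then show "u \<rightarrow>\<^sup>*\<^bsub>with_proj (mk_symmetric (with_proj ?G))\<^esub> v"
      by (rule reachable_mk_symmetricI)
  qed
  moreover have "eccentricity ?G w \<le> ?r"
    unfolding eccentricity_def pverts_hurwitz_graph
  proof (subst Max_le_iff)
    have "graph_dist ?G w u \<le> ?r" if "u \<in> factorizations n" for u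
    proof -
      obtain j where "j \<le> (n - 1) choose 2" "(hurwitz_move ^^ j) w u" using from_w \<open>u \<in> _\<close> by blast
      then have "graph_dist ?G w u \<le> ereal (real j)" using graph_dist_le w by blast
      also have "\<dots> \<le> ?r" using \<open>j \<le> _\<close> by simp
      finally show ?thesis .
    qed
    then show "\<forall>a\<in>graph_dist ?G w ` factorizations n. a \<le> ?r" by blast
  qed (use w finite_factorizations in auto)
  moreover have lower: "?r \<le> eccentricity ?G v" if v: "v \<in> factorizations n" for v
  proof -
    obtain u where u: "u \<in> factorizations n" "\<And>k. (hurwitz_move ^^ k) v u \<Longrightarrow> (n - 1) choose 2 \<le> k"
      using distant_factorization[OF v n] by blast
    have "?r \<le> graph_dist ?G v u" by (rule graph_dist_ge) (rule u(2))
    also have "\<dots> \<le> eccentricity ?G v"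
      unfolding eccentricity_def pverts_hurwitz_graph
      using u(1) finite_factorizations by (intro Max_ge) auto
    finally show ?thesis .
  qed
  ultimately have "eccentricity ?G w = ?r" using w by (intro antisym) auto
  moreover have "radius ?G = eccentricity ?G w"
    unfolding radius_def pverts_hurwitz_graph
  proof (rule Min_eqI)
    show "eccentricity ?G w \<in> eccentricity ?G ` factorizations n" using w by blast
  qed (use lower finite_factorizations \<open>eccentricity ?G w = ?r\<close> in auto)
  ultimately show ?thesis
    using w \<open>connected _\<close> pair_graph_hurwitz_graph
    by (simp add: central_vertex_def pverts_hurwitz_graph)
qed

end


section \<open>Geometric trees\<close>

lemma tree_on_if_undirected_tree:
  assumes "undirected_tree T"
  shows "tree_on (pverts T) (parcs T)"
proof -
  interpret pair_graph T using assms by (simp add: undirected_tree_def)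
  have sym: "(b, a) \<in> parcs T" if "(a, b) \<in> parcs T" for a b using arcs_symmetric[OF that] .
  have "parcs (mk_symmetric (with_proj T)) \<subseteq> parcs T"
    using sym by (auto simp: mk_symmetric_def)
  then have sub: "(parcs (mk_symmetric (with_proj T)))\<^sup>* \<subseteq> (parcs T)\<^sup>*" by (rule rtrancl_mono)
  have "(x, y) \<in> (parcs T)\<^sup>*" if "x \<in> pverts T" "y \<in> pverts T" for x y
  proof -
    have "x \<rightarrow>\<^sup>*\<^bsub>with_proj (mk_symmetric (with_proj T))\<^esub> y"
      using assms that
      by (simp add: undirected_tree_def Digraph_Component.connected_def strongly_connected_def)
    then have "(x, y) \<in> (parcs (mk_symmetric (with_proj T)))\<^sup>*"
      unfolding reachable_def with_proj_simps by (rule rtrancl_on_rtranclI)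
    then show ?thesis using sub by blast
  qed
  moreover have "(a, b) \<notin> (parcs T - {(a, b), (b, a)})\<^sup>*" if ab: "(a, b) \<in> parcs T" for a b
  proof
    \<comment> \<open>Shorten a detour around the edge to a path without repeated vertices; together with the edge
      it is a cycle. Its length is at least 3 because the detour is not the edge itself.\<close>
    assume path: "(a, b) \<in> (parcs T - {(a, b), (b, a)})\<^sup>*"
    define H where "H = \<lparr>pverts = pverts T, parcs = parcs T - {(a, b), (b, a)}\<rparr>"
    interpret H: pair_wf_digraph H
      by unfold_locales (auto simp: H_def dest: in_arcsD1 in_arcsD2)
    have "a \<noteq> b" using ab no_loops' by blast
    have "a \<rightarrow>\<^sup>*\<^bsub>with_proj H\<^esub> b"
      unfolding reachable_def
      by (rule rtrancl_consistent_rtrancl_on) (use path ab in \<open>auto simp: H_def dest: in_arcsD1 in_arcsD2\<close>)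
    then obtain p where p: "H.apath a p b" using H.reachable_apath by blast
    then have cas: "pcas a p b" "set p \<subseteq> parcs T - {(a, b), (b, a)}" "distinct (pawalk_verts a p)"
    proof -
      have "parcs H = parcs T - {(a, b), (b, a)}" by (simp add: H_def)
      then show "pcas a p b" "set p \<subseteq> parcs T - {(a, b), (b, a)}" "distinct (pawalk_verts a p)"
        using p unfolding H.apath_def H.awalk_def by simp_all
    qed
    obtain e q where q: "p = e # q" "fst e = a" "pcas (snd e) q b"
      using cas(1) \<open>a \<noteq> b\<close> by (cases p) auto
    have "q \<noteq> []"
    proof
      assume "q = []"
      then have "e = (a, b)" using q by (auto simp: prod_eq_iff)
      then show False using cas(2) q(1) by auto
    qed
    have snoc: "pcas u r v \<Longrightarrow> pcas u (r @ [(v, x)]) x" for u r v x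
      by (induction r arbitrary: u) auto
    have "set (p @ [(b, a)]) \<subseteq> parcs T" using cas(2) sym[OF ab] by auto
    then have awalk: "awalk a (p @ [(b, a)]) a"
      using snoc[OF cas(1)] in_arcsD1[OF ab] unfolding awalk_def by blast
    have verts: "pcas u r v \<Longrightarrow> pawalk_verts u (r @ [(v, x)]) = pawalk_verts u r @ [x]" for u r v x
      by (induction r arbitrary: u) auto
    have "distinct (tl (pawalk_verts a (p @ [(b, a)])))"
      using cas(3) q unfolding verts[OF cas(1)] by (cases q) auto
    then have "pre_digraph.cycle (with_proj T) (p @ [(b, a)])"
      using awalk unfolding cycle_def by (intro exI[of _ a]) auto
    moreover have "length (p @ [(b, a)]) \<ge> 3" using q \<open>q \<noteq> []\<close> by (cases q) auto
    ultimately show False using assms unfolding undirected_tree_def by blast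
  qed
  moreover have "parcs T \<subseteq> pverts T \<times> pverts T" using in_arcsD1 in_arcsD2 by auto
  ultimately show ?thesis
    using sym no_loops' unfolding tree_on_def sym_def irrefl_def by blast
qed

text \<open>
  The expression is twice the signed area of the triangle with vertices \<open>cis \<alpha>\<close>, \<open>cis \<beta>\<close>, \<open>cis \<gamma>\<close>,
  which are met in counterclockwise order.
\<close>

lemma sin_triangle_pos:
  fixes \<alpha> \<beta> \<gamma> :: real
  assumes "\<alpha> < \<beta>" "\<beta> < \<gamma>" "\<gamma> < \<alpha> + 2 * pi"
  shows "0 < sin (\<beta> - \<alpha>) + sin (\<gamma> - \<beta>) - sin (\<gamma> - \<alpha>)"
proof -
  define x y where "x = (\<beta> - \<alpha>) / 2" and "y = (\<gamma> - \<beta>) / 2"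
  have "sin (2 * x + 2 * y) = 2 * sin x * cos x * (1 - 2 * sin y ^ 2) + (1 - 2 * sin x ^ 2) * (2 * sin y * cos y)"
    by (simp add: sin_add sin_double cos_double_sin)
  then have product: "sin (2 * x) + sin (2 * y) - sin (2 * x + 2 * y) = 4 * sin x * sin y * sin (x + y)"
    unfolding sin_double sin_add[of x y] by algebra
  have angles: "\<beta> - \<alpha> = 2 * x" "\<gamma> - \<beta> = 2 * y" "\<gamma> - \<alpha> = 2 * x + 2 * y"
    by (simp_all add: x_def y_def field_simps)
  have "0 < sin x" "0 < sin y" "0 < sin (x + y)"
    using assms by (auto intro!: sin_gt_zero simp: x_def y_def field_simps)
  then show ?thesis unfolding angles product by simp
qed

text \<open>
  Four points \<open>A\<close>, \<open>B\<close>, \<open>C\<close>, \<open>D\<close> of the plane satisfy an affine relation whose coefficients are the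
  areas of the triangles formed by the other three. When they lie on a circle with \<open>A B\<close> and \<open>C D\<close>
  interleaving, it reads \<open>P A + Q B = R C + U D\<close> with all coefficients positive and \<open>P + Q = R + U\<close>;
  dividing by that sum exhibits the common point of the chords.
\<close>

lemma chords_cross:
  fixes z :: complex and r :: real
  assumes "d < b" "b < c" "c < a" "a < d + 2 * pi"
  defines "q \<equiv> \<lambda>\<phi>. z + of_real r * cis \<phi>"
  shows "closed_segment (q a) (q b) \<inter> closed_segment (q c) (q d) \<noteq> {}"
proof -
  define P where "P = sin (b - d) + sin (c - b) - sin (c - d)"
  define Q where "Q = sin (c - d) + sin (a - c) - sin (a - d)"
  define R where "R = sin (b - d) + sin (a - b) - sin (a - d)"
  define U where "U = sin (c - b) + sin (a - c) - sin (a - b)"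
  have pos: "P > 0" "Q > 0" "R > 0" "U > 0"
    unfolding P_def Q_def R_def U_def using assms by (intro sin_triangle_pos; simp)+
  have sum: "P + Q = R + U" by (simp add: P_def Q_def R_def U_def)
  have re: "P * cos a + Q * cos b = R * cos c + U * cos d"
    unfolding P_def Q_def R_def U_def sin_diff by algebra
  have im: "P * sin a + Q * sin b = R * sin c + U * sin d"
    unfolding P_def Q_def R_def U_def sin_diff by algebra
  have mix: "of_real P * cis a + of_real Q * cis b = of_real R * cis c + of_real U * cis d"
    using re im by (simp add: complex_eq_iff)
  have "(1 - s / (t + s)) *\<^sub>R q \<phi> + (s / (t + s)) *\<^sub>R q \<psi>
      = z + of_real (r / (t + s)) * (of_real t * cis \<phi> + of_real s * cis \<psi>)"
    if "t > 0" "s > 0" for s t \<phi> \<psi>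
  proof -
    have coeff: "1 - s / (t + s) = t / (t + s)" using that by (simp add: field_simps)
    have "t / (t + s) + s / (t + s) = 1" using that by (simp add: add_divide_distrib[symmetric])
    moreover have "(t / (t + s)) *\<^sub>R q \<phi> + (s / (t + s)) *\<^sub>R q \<psi>
        = of_real (t / (t + s) + s / (t + s)) * z + of_real (r / (t + s)) * (of_real t * cis \<phi> + of_real s * cis \<psi>)"
      by (simp add: q_def scaleR_conv_of_real algebra_simps add_divide_distrib)
    ultimately show ?thesis unfolding coeff by simp
  qed
  from this[of P Q a b] this[of R U c d]
  have "(1 - Q / (P + Q)) *\<^sub>R q a + (Q / (P + Q)) *\<^sub>R q b
      = (1 - U / (R + U)) *\<^sub>R q c + (U / (R + U)) *\<^sub>R q d"
    using pos mix sum by simp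
  moreover have "0 \<le> Q / (P + Q)" "Q / (P + Q) \<le> 1" "0 \<le> U / (R + U)" "U / (R + U) \<le> 1"
    using pos by auto
  ultimately show ?thesis
    unfolding closed_segment_def by blast
qed

lemma uncrossed_if_non_crossing:
  assumes "clockwise_on_circle n p" "non_crossing p T" "parcs T \<subseteq> {1..n} \<times> {1..n}"
  shows "uncrossed (parcs T)"
  unfolding uncrossed_def
proof (intro allI impI notI, elim conjE)
  fix a b c d
  assume ab: "(a, b) \<in> parcs T" and cd: "(c, d) \<in> parcs T" and less: "a < c" "c < b" "b < d"
  obtain z r \<theta> where p: "\<And>i. i \<in> {1..n} \<Longrightarrow> p i = z + of_real r * cis (\<theta> i)"
    and \<theta>: "\<And>i j. i \<in> {1..n} \<Longrightarrow> j \<in> {1..n} \<Longrightarrow> i < j \<Longrightarrow> \<theta> j < \<theta> i \<and> \<theta> i < \<theta> j + 2 * pi"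
    using assms(1) unfolding clockwise_on_circle_def by blast
  have mem: "a \<in> {1..n}" "b \<in> {1..n}" "c \<in> {1..n}" "d \<in> {1..n}" using ab cd assms(3) by auto
  have "closed_segment (p a) (p b) \<inter> closed_segment (p c) (p d) \<noteq> {}"
    using chords_cross[of "\<theta> d" "\<theta> b" "\<theta> c" "\<theta> a" z r] \<theta>[of a c] \<theta>[of c b] \<theta>[of b d] \<theta>[of a d] less mem p
    by simp
  moreover have "closed_segment (p a) (p b) \<inter> closed_segment (p c) (p d) \<subseteq> p ` ({a, b} \<inter> {c, d})"
    using assms(2) ab cd less unfolding non_crossing_def by (fastforce simp: doubleton_eq_iff)
  ultimately show False using less by auto
qed

theorem theorem4p2p1:
  fixes n :: nat and p :: "nat \<Rightarrow> complex" and T :: "nat pair_pre_digraph"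
  assumes "n \<ge> 1"
    and "clockwise_on_circle n p"
    and "non_crossing_tree n p T"
  shows "\<exists>w \<in> factorizations n. \<Gamma> n w = T \<and> central_vertex (hurwitz_graph n) w"
proof -
  have T: "pverts T = {1..n}" "undirected_tree T" "non_crossing p T"
    using assms(3) by (auto simp: non_crossing_tree_def)
  have tree: "tree_on {1..n} (parcs T)" using tree_on_if_undirected_tree[OF T(2)] T(1) by simp
  then have sub: "parcs T \<subseteq> {1..n} \<times> {1..n}" by (simp add: tree_on_def)
  have set: "set [1..<Suc n] = {1..n}" and len: "length [1..<Suc n] = n" by auto
  have "sorted_wrt (<) [1..<Suc n]" "[1..<Suc n] \<noteq> []"
    using assms(1) by (simp_all only: sorted_wrt_upt) simp
  then obtain w where w: "set w = {\<langle>a \<leftrightarrow> b\<rangle> | a b. (a, b) \<in> parcs T}" "length w = n - 1"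
    "prod_list w = \<langle>[1..<Suc n]\<rangle>"
    "\<And>u. length u = n - 1 \<Longrightarrow> set u \<subseteq> transpositions_on {1..n} \<Longrightarrow> prod_list u = \<langle>[1..<Suc n]\<rangle> \<Longrightarrow>
       within_moves ((n - 1) choose 2) u w"
    using central_word_exists[of "[1..<Suc n]" "parcs T"] tree uncrossed_if_non_crossing[OF assms(2) T(3) sub]
    unfolding set len by blast
  have irr: "a \<noteq> b" if "(a, b) \<in> parcs T" for a b
    using tree that by (auto simp: tree_on_def irrefl_def)
  have sym: "(b, a) \<in> parcs T" if "(a, b) \<in> parcs T" for a b
    using tree that by (auto simp: tree_on_def sym_def)
  have "w \<in> factorizations n"
    using w(1-3) irr sub by (auto simp: factorizations_def transpositions_eq long_cycle_def)
  moreover have "parcs (\<Gamma> n w) = parcs T"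
  proof (rule set_eqI, clarify)
    fix a b
    show "(a, b) \<in> parcs (\<Gamma> n w) \<longleftrightarrow> (a, b) \<in> parcs T"
    proof
      assume "(a, b) \<in> parcs (\<Gamma> n w)"
      then obtain c d where "(c, d) \<in> parcs T" "\<langle>a \<leftrightarrow> b\<rangle> = \<langle>c \<leftrightarrow> d\<rangle>" "a \<noteq> b"
        by (auto simp: \<Gamma>_def w(1))
      then show "(a, b) \<in> parcs T" using sym by (metis doubleton_eq_iff swap_eq_iff)
    next
      assume "(a, b) \<in> parcs T"
      then show "(a, b) \<in> parcs (\<Gamma> n w)" using sub irr by (auto simp: \<Gamma>_def w(1))
    qed
  qed
  then have "\<Gamma> n w = T" using T(1) by (cases T) (simp add: \<Gamma>_def)
  moreover have "central_vertex (hurwitz_graph n) w"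
    using \<open>w \<in> factorizations n\<close> assms(1)
    by (rule central_vertexI) (intro w(4) factorizationsD, assumption+)
  ultimately show ?thesis by blast
qed

end
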